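(* Let $K$ be an algebraically closed field of arbitrary characteristic, let $\mathfrak{m}=\langle x_1,\ldots,x_n\rangle\subset K[[x_1,\ldots,x_n]]$ and let $0\neq f\in\mathfrak{m}^2$. (a) If $\mu(f)<\infty$, then the right determinacy of $f$ is at most $2\mu(f)-\operatorname{ord}(f)+2$. (b) If $\tau(f)<\infty$, then the contact determinacy of $f$ is at most $2\tau(f)-\operatorname{ord}(f)+2$.
   Context: $\mu(f)=\dim_K K[[x_1,\ldots,x_n]]/\langle f_{x_1},\ldots,f_{x_n}\rangle$ is the Milnor number and $\tau(f)=\dim_K K[[x_1,\ldots,x_n]]/\langle f,f_{x_1},\ldots,f_{x_n}\rangle$ is the Tjurina number. $\operatorname{ord}(f)$ is the largest integer $o$ with $f\in\mathfrak{m}^o$. Power series $f,g$ are right equivalent if $f=\varphi(g)$ for some $K$-algebra automorphism $\varphi$ of $K[[x_1,\ldots,x_n]]$; they are contact equivalent if $f=u\cdot\varphi(g)$ for some such $\varphi$ and some unit $u$. $f$ is right (respectively contact) $k$-determined if $f$ is right (respectively contact) equivalent to every $g$ with $f-g\in\mathfrak{m}^{k+1}$. The right (respectively contact) determinacy of $f$ is the least $k$ such that $f$ is right (respectively contact) $k$-determined; the claim includes that such a $k$ exists. *)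

theory Defs
  imports
    "HOL-Computational_Algebra.Computational_Algebra"
    "HOL-Library.Poly_Mapping"
    "HOL-Library.Extended_Nat"
begin

section \<open>Formal power series in finitely many variables\<close>

text \<open>
  The variables are indexed by a type \<open>'n\<close> of class \<^class>\<open>finite\<close>, so \<open>('n, 'a) mfps\<close> is the ring
  of formal power series over \<open>'a\<close> in \<open>CARD('n)\<close> variables. Exponent vectors are elements
  of \<open>'n \<Rightarrow>\<^sub>0 nat\<close>.
\<close>

typedef ('n, 'a) mfps = "UNIV :: (('n \<Rightarrow>\<^sub>0 nat) \<Rightarrow> 'a) set"
  morphisms mfps_nth Abs_mfps ..

setup_lifting type_definition_mfps

lemma mfps_eqI: "(\<And>m. mfps_nth f m = mfps_nth g m) \<Longrightarrow> f = g"
  by transfer auto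

lemma finite_splittings:
  fixes m :: "'n::finite \<Rightarrow>\<^sub>0 nat"
  shows "finite {(a, b). a + b = m}"
proof -
  have fin: "finite {f :: 'n \<Rightarrow> nat. \<forall>i. f i \<le> Poly_Mapping.lookup m i}"
  proof (rule finite_subset)
    show "{f :: 'n \<Rightarrow> nat. \<forall>i. f i \<le> Poly_Mapping.lookup m i} \<subseteq> {f. \<forall>i. (i \<in> UNIV \<longrightarrow> f i \<in> {..Max (range (Poly_Mapping.lookup m))}) \<and> (i \<notin> UNIV \<longrightarrow> f i = 0)}"
    proof clarsimp
      fix f :: "'n \<Rightarrow> nat" and i
      assume "\<forall>i. f i \<le> Poly_Mapping.lookup m i"
      moreover have "Poly_Mapping.lookup m i \<le> Max (range (Poly_Mapping.lookup m))"
        by (rule Max_ge) auto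
      ultimately show "f i \<le> Max (range (Poly_Mapping.lookup m))"
        using order_trans by blast
    qed
    show "finite {f :: 'n \<Rightarrow> nat. \<forall>i. (i \<in> UNIV \<longrightarrow> f i \<in> {..Max (range (Poly_Mapping.lookup m))}) \<and> (i \<notin> UNIV \<longrightarrow> f i = 0)}"
      by (rule finite_set_of_finite_funs) auto
  qed
  have "inj_on Poly_Mapping.lookup A" for A :: "('n \<Rightarrow>\<^sub>0 nat) set"
    by (rule inj_onI) (rule poly_mapping_eqI, simp)
  moreover have "Poly_Mapping.lookup ` fst ` {(a, b). a + b = m} \<subseteq> {f. \<forall>i. f i \<le> Poly_Mapping.lookup m i}"
    by (auto simp: lookup_add)
  ultimately have "finite (fst ` {(a, b). a + b = m})"
    by (rule inj_on_finite[OF _ _ fin])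
  moreover have "inj_on fst {(a, b). a + b = m}"
    by (rule inj_onI) auto
  ultimately show ?thesis
    by (rule finite_imageD)
qed

instantiation mfps :: (finite, comm_ring_1) comm_ring_1
begin

lift_definition zero_mfps :: "('a, 'b) mfps" is "\<lambda>_. 0" .

lift_definition one_mfps :: "('a, 'b) mfps" is "\<lambda>m. if m = 0 then 1 else 0" .

lift_definition plus_mfps :: "('a, 'b) mfps \<Rightarrow> ('a, 'b) mfps \<Rightarrow> ('a, 'b) mfps"
  is "\<lambda>f g m. f m + g m" .

lift_definition minus_mfps :: "('a, 'b) mfps \<Rightarrow> ('a, 'b) mfps \<Rightarrow> ('a, 'b) mfps"
  is "\<lambda>f g m. f m - g m" .

lift_definition uminus_mfps :: "('a, 'b) mfps \<Rightarrow> ('a, 'b) mfps"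
  is "\<lambda>f m. - f m" .

lift_definition times_mfps :: "('a, 'b) mfps \<Rightarrow> ('a, 'b) mfps \<Rightarrow> ('a, 'b) mfps"
  is "\<lambda>f g m. \<Sum>(a, b) \<in> {(a, b). a + b = m}. f a * g b" .

instance
proof
  fix f g h :: "('a, 'b) mfps"
  show "f + g + h = f + (g + h)" "f + g = g + f" "0 + f = f" "- f + f = 0" "f - g = f + - g"
    by (transfer; simp add: fun_eq_iff algebra_simps)+
  show "(0 :: ('a, 'b) mfps) \<noteq> 1"
    by transfer (auto simp: fun_eq_iff)
  show "f * g = g * f"
  proof (transfer, rule ext)
    fix f g :: "('a \<Rightarrow>\<^sub>0 nat) \<Rightarrow> 'b" and m :: "'a \<Rightarrow>\<^sub>0 nat"
    show "(\<Sum>(a, b) \<in> {(a, b). a + b = m}. f a * g b) = (\<Sum>(a, b) \<in> {(a, b). a + b = m}. g a * f b)"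
      by (rule sum.reindex_bij_witness[of _ prod.swap prod.swap])
        (auto simp: mult.commute add.commute)
  qed
  show "1 * f = f"
  proof (transfer, rule ext)
    fix f :: "('a \<Rightarrow>\<^sub>0 nat) \<Rightarrow> 'b" and m :: "'a \<Rightarrow>\<^sub>0 nat"
    have "(\<Sum>(a, b) \<in> {(a, b). a + b = m}. (if a = 0 then 1 else 0) * f b)
        = (\<Sum>(a, b) \<in> {(0 :: 'a \<Rightarrow>\<^sub>0 nat, m)}. (if a = 0 then 1 else 0) * f b)"
      by (rule sum.mono_neutral_right) (auto simp: finite_splittings split: if_splits)
    then show "(\<Sum>(a, b) \<in> {(a, b). a + b = m}. (if a = 0 then 1 else 0) * f b) = f m"
      by simp
  qed
  show "(f + g) * h = f * h + g * h"
    by transfer (auto simp: fun_eq_iff case_prod_unfold ring_distribs sum.distrib)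
  show "f * g * h = f * (g * h)"
  proof (transfer, rule ext)
    fix f g h :: "('a \<Rightarrow>\<^sub>0 nat) \<Rightarrow> 'b" and m :: "'a \<Rightarrow>\<^sub>0 nat"
    have "(\<Sum>(s, c) \<in> {(s, c). s + c = m}. (\<Sum>(a, b) \<in> {(a, b). a + b = s}. f a * g b) * h c)
        = (\<Sum>((s, c), (a, b)) \<in> (SIGMA (s, c) : {(s, c). s + c = m}. {(a, b). a + b = s}). f a * g b * h c)"
      by (simp add: sum_distrib_right case_prod_unfold sum.Sigma finite_splittings[unfolded case_prod_unfold])
    also have "\<dots> = (\<Sum>((a, t), (b, c)) \<in> (SIGMA (a, t) : {(a, t). a + t = m}. {(b, c). b + c = t}). f a * (g b * h c))"
      by (rule sum.reindex_bij_witness[of _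
            "\<lambda>((a, t), (b, c)). ((a + b, c), (a, b))" "\<lambda>((s, c), (a, b)). ((a, b + c), (b, c))"])
        (auto simp: ac_simps)
    also have "\<dots> = (\<Sum>(a, t) \<in> {(a, t). a + t = m}. f a * (\<Sum>(b, c) \<in> {(b, c). b + c = t}. g b * h c))"
      by (simp add: sum_distrib_left case_prod_unfold sum.Sigma finite_splittings[unfolded case_prod_unfold])
    finally show "(\<Sum>(s, c) \<in> {(s, c). s + c = m}. (\<Sum>(a, b) \<in> {(a, b). a + b = s}. f a * g b) * h c)
        = (\<Sum>(a, t) \<in> {(a, t). a + t = m}. f a * (\<Sum>(b, c) \<in> {(b, c). b + c = t}. g b * h c))" .
  qed
qed

end

lift_definition mfps_X :: "'n \<Rightarrow> ('n, 'a::zero_neq_one) mfps"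
  is "\<lambda>i m. if m = Poly_Mapping.single i 1 then 1 else 0" .

lift_definition mfps_pderiv :: "'n \<Rightarrow> ('n, 'a::semiring_1) mfps \<Rightarrow> ('n, 'a) mfps"
  is "\<lambda>i f m. of_nat (Poly_Mapping.lookup m i + 1) * f (m + Poly_Mapping.single i 1)" .

lift_definition mfps_scale :: "'a::times \<Rightarrow> ('n, 'a) mfps \<Rightarrow> ('n, 'a) mfps"
  is "\<lambda>c f m. c * f m" .

lemma mfps_scale_mult_left:
  fixes f g :: "('n::finite, 'a::comm_ring_1) mfps"
  shows "mfps_scale c (f * g) = mfps_scale c f * g"
  by transfer (simp add: fun_eq_iff sum_distrib_left case_prod_unfold mult.assoc)

interpretation mfps_vs: vector_space "mfps_scale :: 'a::field \<Rightarrow> ('n::finite, 'a) mfps \<Rightarrow> ('n, 'a) mfps"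
  by unfold_locales (transfer; simp add: fun_eq_iff algebra_simps)+


section \<open>Ideals, order and dimension of quotients\<close>

interpretation ideal: module "(*) :: 'r::comm_ring_1 \<Rightarrow> 'r \<Rightarrow> 'r"
  by unfold_locales (simp_all add: algebra_simps)

abbreviation ideal_gen :: "'r::comm_ring_1 set \<Rightarrow> 'r set" where
  "ideal_gen \<equiv> module.span (*)"

primrec ideal_pow :: "'r::comm_ring_1 set \<Rightarrow> nat \<Rightarrow> 'r set" where
  "ideal_pow I 0 = UNIV"
| "ideal_pow I (Suc k) = ideal_gen {a * b | a b. a \<in> I \<and> b \<in> ideal_pow I k}"

definition mfps_max_ideal :: "('n::finite, 'a::comm_ring_1) mfps set" where
  "mfps_max_ideal = ideal_gen (range mfps_X)"

definition mfps_ord :: "('n::finite, 'a::comm_ring_1) mfps \<Rightarrow> nat" where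
  "mfps_ord f = (GREATEST k. f \<in> ideal_pow mfps_max_ideal k)"

lemma ideal_pow_imp_nth_eq_0:
  fixes f :: "('n::finite, 'a::comm_ring_1) mfps"
  assumes "f \<in> ideal_pow mfps_max_ideal k" "(\<Sum>i\<in>UNIV. Poly_Mapping.lookup m i) < k"
  shows "mfps_nth f m = 0"
proof -
  define J :: "nat \<Rightarrow> ('n, 'a) mfps set"
    where "J k = {f. \<forall>m. (\<Sum>i\<in>UNIV. Poly_Mapping.lookup m i) < k \<longrightarrow> mfps_nth f m = 0}" for k
  have mult: "f * g \<in> J (k + l)" if "f \<in> J k" "g \<in> J l" for f g k l
  proof -
    have "mfps_nth f a * mfps_nth g b = 0" if "(\<Sum>i\<in>UNIV. Poly_Mapping.lookup (a + b) i) < k + l" for a b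
    proof -
      have "(\<Sum>i\<in>UNIV. Poly_Mapping.lookup a i) < k \<or> (\<Sum>i\<in>UNIV. Poly_Mapping.lookup b i) < l"
        using that by (auto simp: lookup_add sum.distrib)
      then show ?thesis
        using \<open>f \<in> J k\<close> \<open>g \<in> J l\<close> by (auto simp: J_def)
    qed
    then show ?thesis
      by (auto simp: J_def times_mfps.rep_eq intro!: sum.neutral)
  qed
  have sub: "ideal.subspace (J k)" for k
  proof (rule ideal.subspaceI)
    show "c * x \<in> J k" if "x \<in> J k" for c x
      using mult[of c 0 x k] that by (simp add: J_def)
  qed (auto simp: J_def zero_mfps.rep_eq plus_mfps.rep_eq)
  have "(\<Sum>i\<in>UNIV. Poly_Mapping.lookup (Poly_Mapping.single j (1 :: nat)) i) = 1" for j :: 'n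
    by (simp add: lookup_single when_def)
  then have "mfps_X j \<in> J 1" for j
    unfolding J_def mem_Collect_eq mfps_X.rep_eq by (metis less_irrefl)
  then have "range mfps_X \<subseteq> J 1"
    by blast
  then have m1: "mfps_max_ideal \<subseteq> J 1"
    unfolding mfps_max_ideal_def by (rule ideal.span_minimal[OF _ sub])
  have "ideal_pow mfps_max_ideal k \<subseteq> J k" for k
  proof (induction k)
    case 0
    show ?case by (simp add: J_def)
  next
    case (Suc k)
    have "{a * b | a b. a \<in> mfps_max_ideal \<and> b \<in> ideal_pow mfps_max_ideal k} \<subseteq> J (Suc k)"
      using mult[of _ 1 _ k] m1 Suc by fastforce
    then show ?case
      unfolding ideal_pow.simps by (rule ideal.span_minimal[OF _ sub])
  qed
  then show ?thesis
    using assms by (auto simp: J_def)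
qed

lemma mfps_ord:
  assumes "f \<noteq> 0"
  shows "f \<in> ideal_pow mfps_max_ideal (mfps_ord f)"
    and "f \<in> ideal_pow mfps_max_ideal k \<Longrightarrow> k \<le> mfps_ord f"
proof -
  obtain m where "mfps_nth f m \<noteq> 0"
    using assms by (metis mfps_eqI zero_mfps.rep_eq)
  then have bound: "k \<le> (\<Sum>i\<in>UNIV. Poly_Mapping.lookup m i)" if "f \<in> ideal_pow mfps_max_ideal k" for k
    using ideal_pow_imp_nth_eq_0 that not_le by metis
  have "f \<in> ideal_pow mfps_max_ideal 0"
    by simp
  then show "f \<in> ideal_pow mfps_max_ideal (mfps_ord f)"
    unfolding mfps_ord_def using bound
    by (rule GreatestI_nat[where P = "\<lambda>k. f \<in> ideal_pow mfps_max_ideal k"])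
  show "k \<le> mfps_ord f" if "f \<in> ideal_pow mfps_max_ideal k"
    unfolding mfps_ord_def using that bound
    by (rule Greatest_le_nat[where P = "\<lambda>k. f \<in> ideal_pow mfps_max_ideal k"])
qed

text \<open>
  \<open>basis_mod I B\<close>: the residue classes of the elements of the finite set \<open>B\<close> are pairwise distinct
  and form a basis of the vector space of power series modulo the subspace \<open>I\<close>.
\<close>

definition basis_mod :: "('n::finite, 'k::field) mfps set \<Rightarrow> ('n, 'k) mfps set \<Rightarrow> bool" where
  "basis_mod I B \<longleftrightarrow> finite B
     \<and> (\<forall>c. (\<Sum>b\<in>B. mfps_scale (c b) b) \<in> I \<longrightarrow> (\<forall>b\<in>B. c b = 0))
     \<and> (\<forall>f. \<exists>c. f - (\<Sum>b\<in>B. mfps_scale (c b) b) \<in> I)"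

definition quotient_dim :: "('n::finite, 'k::field) mfps set \<Rightarrow> enat" where
  "quotient_dim I = (if \<exists>B. basis_mod I B then enat (card (SOME B. basis_mod I B)) else \<infinity>)"

lemma subspace_ideal_gen:
  "mfps_vs.subspace (ideal_gen S :: ('n::finite, 'k::field) mfps set)"
proof (rule mfps_vs.subspaceI)
  show "(0 :: ('n, 'k) mfps) \<in> ideal_gen S"
    by (rule ideal.span_zero)
  show "x + y \<in> ideal_gen S" if "x \<in> ideal_gen S" "y \<in> ideal_gen S" for x y :: "('n, 'k) mfps"
    using that by (rule ideal.span_add)
  show "mfps_scale c x \<in> ideal_gen S" if "x \<in> ideal_gen S" for c and x :: "('n, 'k) mfps"
    using ideal.span_scale[OF that, of "mfps_scale c 1"] mfps_scale_mult_left[of c 1 x] by simp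
qed

lemma basis_mod_card_le:
  fixes I :: "('n::finite, 'k::field) mfps set"
  assumes I: "mfps_vs.subspace I" and B: "basis_mod I B" and C: "basis_mod I C"
  shows "card C \<le> card B"
proof -
  have fin: "finite B" "finite C"
    using B C by (auto simp: basis_mod_def)
  define p where "p f = (SOME g. g \<in> mfps_vs.span B \<and> f - g \<in> I)" for f
  have p: "p f \<in> mfps_vs.span B \<and> f - p f \<in> I" for f
  proof -
    obtain c where "f - (\<Sum>b\<in>B. mfps_scale (c b) b) \<in> I"
      using B unfolding basis_mod_def by blast
    moreover have "(\<Sum>b\<in>B. mfps_scale (c b) b) \<in> mfps_vs.span B"
      by (intro mfps_vs.span_sum mfps_vs.span_scale mfps_vs.span_base)
    ultimately have "\<exists>g. g \<in> mfps_vs.span B \<and> f - g \<in> I"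
      by blast
    then show ?thesis
      unfolding p_def by (rule someI_ex)
  qed
  have ind: "\<forall>b\<in>C. c b = 0" if "(\<Sum>b\<in>C. mfps_scale (c b) (p b)) = 0" for c
  proof -
    have "(\<Sum>b\<in>C. mfps_scale (c b) b) = (\<Sum>b\<in>C. mfps_scale (c b) (b - p b))"
      using that by (simp add: mfps_vs.scale_right_diff_distrib sum_subtractf)
    also have "\<dots> \<in> I"
      using p by (intro mfps_vs.subspace_sum mfps_vs.subspace_scale I) auto
    finally show ?thesis
      using C unfolding basis_mod_def by blast
  qed
  have inj: "inj_on p C"
  proof (rule inj_onI, rule ccontr)
    fix x y assume xy: "x \<in> C" "y \<in> C" "p x = p y" "x \<noteq> y"
    let ?c = "\<lambda>b. if b = x then 1 else if b = y then - 1 else (0 :: 'k)"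
    have "(\<Sum>b\<in>C. mfps_scale (?c b) (p b)) = (\<Sum>b\<in>{x, y}. mfps_scale (?c b) (p b))"
      using xy fin by (intro sum.mono_neutral_right) auto
    also have "\<dots> = 0"
      using xy by simp
    finally show False
      using ind[of ?c] xy by auto
  qed
  have "mfps_vs.independent (p ` C)"
  proof
    assume "mfps_vs.dependent (p ` C)"
    then obtain u where u: "(\<Sum>v\<in>p ` C. mfps_scale (u v) v) = 0" "\<exists>v\<in>p ` C. u v \<noteq> 0"
      using fin by (auto simp: mfps_vs.dependent_finite)
    then show False
      using ind[of "u \<circ> p"] inj by (auto simp: sum.reindex)
  qed
  moreover have "p ` C \<subseteq> mfps_vs.span B"
    using p by auto
  ultimately have "card (p ` C) \<le> card B"
    using mfps_vs.independent_span_bound fin by blast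
  then show ?thesis
    using inj by (simp add: card_image)
qed

lemma quotient_dim_eq:
  assumes "mfps_vs.subspace I" "basis_mod I B"
  shows "quotient_dim I = enat (card B)"
proof -
  have "basis_mod I (SOME B. basis_mod I B)"
    using assms(2) by (rule someI)
  then show ?thesis
    unfolding quotient_dim_def
    using assms basis_mod_card_le[OF assms(1)] by (auto intro: antisym)
qed

definition milnor_number :: "('n::finite, 'k::field) mfps \<Rightarrow> enat" where
  "milnor_number f = quotient_dim (ideal_gen (range (\<lambda>i. mfps_pderiv i f)))"

definition tjurina_number :: "('n::finite, 'k::field) mfps \<Rightarrow> enat" where
  "tjurina_number f = quotient_dim (ideal_gen (insert f (range (\<lambda>i. mfps_pderiv i f))))"


section \<open>Equivalence and determinacy\<close>

definition mfps_automorphism :: "(('n::finite, 'k::field) mfps \<Rightarrow> ('n, 'k) mfps) \<Rightarrow> bool" where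
  "mfps_automorphism \<phi> \<longleftrightarrow> bij \<phi> \<and> Vector_Spaces.linear mfps_scale mfps_scale \<phi>
     \<and> \<phi> 1 = 1 \<and> (\<forall>f g. \<phi> (f * g) = \<phi> f * \<phi> g)"

definition right_equivalent :: "('n::finite, 'k::field) mfps \<Rightarrow> ('n, 'k) mfps \<Rightarrow> bool" where
  "right_equivalent f g \<longleftrightarrow> (\<exists>\<phi>. mfps_automorphism \<phi> \<and> f = \<phi> g)"

definition contact_equivalent :: "('n::finite, 'k::field) mfps \<Rightarrow> ('n, 'k) mfps \<Rightarrow> bool" where
  "contact_equivalent f g \<longleftrightarrow> (\<exists>\<phi> u. mfps_automorphism \<phi> \<and> u dvd 1 \<and> f = u * \<phi> g)"

definition right_determined :: "nat \<Rightarrow> ('n::finite, 'k::field) mfps \<Rightarrow> bool" where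
  "right_determined k f \<longleftrightarrow>
     (\<forall>g. f - g \<in> ideal_pow mfps_max_ideal (k + 1) \<longrightarrow> right_equivalent f g)"

definition contact_determined :: "nat \<Rightarrow> ('n::finite, 'k::field) mfps \<Rightarrow> bool" where
  "contact_determined k f \<longleftrightarrow>
     (\<forall>g. f - g \<in> ideal_pow mfps_max_ideal (k + 1) \<longrightarrow> contact_equivalent f g)"

text \<open>The determinacy is only meaningful if some such \<open>k\<close> exists.\<close>

definition right_determinacy :: "('n::finite, 'k::field) mfps \<Rightarrow> nat" where
  "right_determinacy f = (LEAST k. right_determined k f)"

definition contact_determinacy :: "('n::finite, 'k::field) mfps \<Rightarrow> nat" where
  "contact_determinacy f = (LEAST k. contact_determined k f)"

end

theory Submission
  imports Defs
begin

text \<open>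
  Let \<open>J\<close> be the Jacobian or Tjurina ideal, of codimension \<open>k\<close>, and \<open>d = ord f\<close>. As the codimension is
  \<open>k\<close>, some \<open>i \<le> k\<close> satisfies \<open>m^i \<subseteq> J + m^(i+1)\<close>, and \<open>J \<subseteq> m^(d-1)\<close> forces \<open>i \<ge> d - 1\<close>. Hence every error
  in \<open>m^(i+e)\<close> agrees modulo \<open>m^(i+e+1)\<close> with some \<open>a f + \<Sum> c_j f_j\<close> whose coefficients lie in \<open>m^e\<close>.
  If \<open>f - g \<in> m^(2i+3-d)\<close>, this solves \<open>u f(x + b) = g\<close> by a Newton iteration which replaces \<open>u\<close> by
  \<open>u + a\<close> and \<open>b\<close> by \<open>b + c\<close>: since \<open>b\<close> and \<open>u - 1\<close> have order at least \<open>i + 3 - d \<ge> 2\<close>, Taylor's formula shows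
  that each step gains one order, although the derivatives are taken at \<open>x\<close> and not at \<open>x + b\<close>.
  Only truncated congruences modulo powers of \<open>m\<close> are used, so Nakayama's lemma is not needed.
\<close>

section \<open>Coefficients of the ring operations\<close>

lemma mfps_nth_simps [simp]:
  fixes f g :: "('n::finite, 'a::comm_ring_1) mfps"
  shows "mfps_nth 0 m = (0 :: 'a)" "mfps_nth (f + g) m = mfps_nth f m + mfps_nth g m"
    "mfps_nth (f - g) m = mfps_nth f m - mfps_nth g m" "mfps_nth (- f) m = - mfps_nth f m"
    "mfps_nth (mfps_scale c f) m = c * mfps_nth f m"
  by (simp_all add: zero_mfps.rep_eq plus_mfps.rep_eq minus_mfps.rep_eq uminus_mfps.rep_eq mfps_scale.rep_eq)

lemma mfps_nth_sum [simp]: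
  fixes f :: "'b \<Rightarrow> ('n::finite, 'a::comm_ring_1) mfps"
  shows "mfps_nth (sum f A) m = (\<Sum>x\<in>A. mfps_nth (f x) m)"
  by (induction A rule: infinite_finite_induct) auto

lemma mfps_nth_mult:
  fixes f g :: "('n::finite, 'a::comm_ring_1) mfps"
  shows "mfps_nth (f * g) m = (\<Sum>(a, b) \<in> {(a, b). a + b = m}. mfps_nth f a * mfps_nth g b)"
  by (simp add: times_mfps.rep_eq)

lemma mfps_nth_one: "mfps_nth (1 :: ('n::finite, 'a::comm_ring_1) mfps) m = (if m = 0 then 1 else 0)"
  by (simp add: one_mfps.rep_eq)

lemma mfps_nth_pderiv:
  fixes f :: "('n::finite, 'a::comm_ring_1) mfps"
  shows "mfps_nth (mfps_pderiv i f) m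
    = of_nat (Poly_Mapping.lookup m i + 1) * mfps_nth f (m + Poly_Mapping.single i 1)"
  by (simp add: mfps_pderiv.rep_eq)

section \<open>The order filtration\<close>

definition mdeg :: "('n::finite \<Rightarrow>\<^sub>0 nat) \<Rightarrow> nat" where
  "mdeg m = (\<Sum>i\<in>UNIV. Poly_Mapping.lookup m i)"

lemma mdeg_0 [simp]: "mdeg 0 = 0"
  by (simp add: mdeg_def)

lemma mdeg_add [simp]: "mdeg (a + b) = mdeg a + mdeg b"
  by (simp add: mdeg_def lookup_add sum.distrib)

lemma mdeg_single [simp]: "mdeg (Poly_Mapping.single i k) = k"
  by (simp add: mdeg_def lookup_single when_def)

lemma mdeg_eq_0_iff [simp]: "mdeg m = 0 \<longleftrightarrow> m = 0"
  by (auto simp: mdeg_def intro: poly_mapping_eqI)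

lemma finite_mdeg_less [simp]: "finite {m :: 'n::finite \<Rightarrow>\<^sub>0 nat. mdeg m < M}"
proof (rule inj_on_finite)
  show "inj_on Poly_Mapping.lookup {m :: 'n \<Rightarrow>\<^sub>0 nat. mdeg m < M}"
    by (rule inj_onI) (rule poly_mapping_eqI, simp)
  show "finite {f :: 'n \<Rightarrow> nat. \<forall>i. (i \<in> UNIV \<longrightarrow> f i \<in> {..M}) \<and> (i \<notin> UNIV \<longrightarrow> f i = 0)}"
    by (rule finite_set_of_finite_funs) auto
  have "Poly_Mapping.lookup m i \<le> M" if "mdeg m < M" for m :: "'n \<Rightarrow>\<^sub>0 nat" and i
    using member_le_sum[of i UNIV "Poly_Mapping.lookup m"] that by (simp add: mdeg_def)
  then show "Poly_Mapping.lookup ` {m :: 'n \<Rightarrow>\<^sub>0 nat. mdeg m < M}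
      \<subseteq> {f. \<forall>i. (i \<in> UNIV \<longrightarrow> f i \<in> {..M}) \<and> (i \<notin> UNIV \<longrightarrow> f i = 0)}"
    by auto
qed

lemma mdeg_Suc_cases:
  assumes "mdeg m = Suc d"
  obtains i m' where "m = m' + Poly_Mapping.single i 1" "mdeg m' = d"
proof -
  obtain i where i: "Poly_Mapping.lookup m i \<noteq> 0"
    using assms unfolding mdeg_def by (metis nat.distinct(1) sum.neutral)
  have "m = (m - Poly_Mapping.single i 1) + Poly_Mapping.single i 1"
    using i by (intro poly_mapping_eqI) (auto simp: lookup_add lookup_minus lookup_single when_def)
  with assms that show thesis
    by (metis Suc_eq_plus1 add_right_cancel mdeg_add mdeg_single)
qed

lemma exponent_induct [case_names zero add]:
  fixes m :: "'n::finite \<Rightarrow>\<^sub>0 nat"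
  assumes "P 0" "\<And>m i. P m \<Longrightarrow> P (m + Poly_Mapping.single i 1)"
  shows "P m"
proof (induction "mdeg m" arbitrary: m)
  case 0
  then show ?case using assms(1) by simp
next
  case (Suc d)
  then show ?case using assms(2) by (metis mdeg_Suc_cases)
qed

text \<open>Serves to write a monomial of large degree as a monomial of exactly prescribed degree
  times a cofactor, in \<open>approximation_shift\<close>.\<close>

lemma exponent_split:
  fixes m :: "'n::finite \<Rightarrow>\<^sub>0 nat"
  assumes "d \<le> mdeg m"
  obtains a b where "m = a + b" "mdeg b = d"
  using assms
proof (induction m arbitrary: d thesis rule: exponent_induct)
  case zero
  then show ?case by simp
next
  case (add m i)
  show ?case
  proof (cases "d \<le> mdeg m")
    case True
    then obtain a b where "m = a + b" "mdeg b = d" using add.IH by blast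
    then show ?thesis using add.prems(1)[of "a + Poly_Mapping.single i 1" b] by (simp add: ac_simps)
  next
    case False
    then show ?thesis using add.prems(1)[of 0] add.prems(2) by simp
  qed
qed

text \<open>This is the power \<open>m^d\<close> of the maximal ideal, described by vanishing
  coefficients so that membership can be checked one coefficient at a time.\<close>

definition order_ge :: "nat \<Rightarrow> ('n::finite, 'a::comm_ring_1) mfps set" where
  "order_ge d = {f. \<forall>m. mdeg m < d \<longrightarrow> mfps_nth f m = 0}"

lemma order_geI: "(\<And>m. mdeg m < d \<Longrightarrow> mfps_nth f m = 0) \<Longrightarrow> f \<in> order_ge d"
  by (simp add: order_ge_def)

lemma order_geD: "f \<in> order_ge d \<Longrightarrow> mdeg m < d \<Longrightarrow> mfps_nth f m = 0"
  by (simp add: order_ge_def)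

lemma ideal_pow_subset_order_ge: "ideal_pow mfps_max_ideal d \<subseteq> order_ge d"
  using ideal_pow_imp_nth_eq_0 by (auto simp: order_ge_def mdeg_def)

lemma order_ge_mono: "f \<in> order_ge e \<Longrightarrow> d \<le> e \<Longrightarrow> f \<in> order_ge d"
  by (auto simp: order_ge_def)

lemma order_ge_0 [simp]: "f \<in> order_ge 0"
  by (simp add: order_ge_def)

lemma zero_in_order_ge [simp]: "0 \<in> order_ge d"
  by (simp add: order_ge_def)

lemma order_ge_add: "f \<in> order_ge d \<Longrightarrow> g \<in> order_ge d \<Longrightarrow> f + g \<in> order_ge d"
  and order_ge_diff: "f \<in> order_ge d \<Longrightarrow> g \<in> order_ge d \<Longrightarrow> f - g \<in> order_ge d"
  and order_ge_minus: "f \<in> order_ge d \<Longrightarrow> - f \<in> order_ge d"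
  and order_ge_scale: "f \<in> order_ge d \<Longrightarrow> mfps_scale c f \<in> order_ge d"
  by (simp_all add: order_ge_def)

lemma order_ge_sum: "(\<And>x. x \<in> A \<Longrightarrow> f x \<in> order_ge d) \<Longrightarrow> sum f A \<in> order_ge d"
  by (induction A rule: infinite_finite_induct) (auto intro: order_ge_add)

lemma order_ge_mult:
  assumes "f \<in> order_ge d" "g \<in> order_ge e"
  shows "f * g \<in> order_ge (d + e)"
proof (rule order_geI)
  fix m :: "'a \<Rightarrow>\<^sub>0 nat" assume "mdeg m < d + e"
  then have "mfps_nth f a * mfps_nth g b = 0" if "a + b = m" for a b
  proof -
    have "mdeg a < d \<or> mdeg b < e" using that \<open>mdeg m < d + e\<close> by fastforce
    then show ?thesis using order_geD[OF assms(1)] order_geD[OF assms(2)] by auto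
  qed
  then show "mfps_nth (f * g) m = 0"
    by (auto simp: mfps_nth_mult intro!: sum.neutral)
qed

lemma order_ge_mult_le:
  assumes "f \<in> order_ge d" "g \<in> order_ge e" "k \<le> d + e"
  shows "f * g \<in> order_ge k"
  using order_ge_mult[OF assms(1,2)] assms(3) by (rule order_ge_mono)

lemma order_ge_mult_left: "g \<in> order_ge d \<Longrightarrow> f * g \<in> order_ge d"
  using order_ge_mult[of f 0 g d] by simp

lemma order_ge_mult_right: "f \<in> order_ge d \<Longrightarrow> f * g \<in> order_ge d"
  using order_ge_mult[of f d g 0] by simp

lemma order_ge_power: "f \<in> order_ge 1 \<Longrightarrow> f ^ k \<in> order_ge k"
  by (induction k) (auto dest: order_ge_mult)

lemma order_ge_prod:
  "(\<And>i. i \<in> A \<Longrightarrow> f i \<in> order_ge (d i)) \<Longrightarrow> prod f A \<in> order_ge (sum d A)"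
  by (induction A rule: infinite_finite_induct) (auto intro: order_ge_mult)

lemma pderiv_order_ge: "f \<in> order_ge d \<Longrightarrow> mfps_pderiv i f \<in> order_ge (d - 1)"
  by (rule order_geI) (simp add: mfps_nth_pderiv order_geD)

section \<open>Separatedness, completeness and unipotent maps\<close>

lemma order_ge_separated:
  assumes "\<And>d. f - g \<in> order_ge d"
  shows "f = g"
  by (rule mfps_eqI) (use order_geD[OF assms lessI] in auto)

text \<open>The coefficient at \<open>m\<close> no longer changes from index
  \<open>Suc (mdeg m)\<close> on, so the limit is read off there. The offset \<open>e\<close>
  records the rate of convergence, so that order bounds on the iterates survive in the
  limit.\<close>

lemma order_ge_complete:
  fixes h :: "nat \<Rightarrow> ('n::finite, 'a::comm_ring_1) mfps"
  assumes "\<And>p. h (Suc p) - h p \<in> order_ge (p + e)"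
  obtains l where "\<And>p. l - h p \<in> order_ge (p + e)"
proof -
  have step: "h (p + k) - h p \<in> order_ge (p + e)" for p k
  proof (induction k)
    case (Suc k)
    have "h (Suc (p + k)) - h (p + k) \<in> order_ge (p + e)"
      using assms[of "p + k"] by (rule order_ge_mono) simp
    from order_ge_add[OF this Suc] show ?case by simp
  qed simp
  define l where "l = Abs_mfps (\<lambda>m. mfps_nth (h (Suc (mdeg m))) m)"
  have l: "mfps_nth l m = mfps_nth (h (Suc (mdeg m))) m" for m
    by (simp add: l_def Abs_mfps_inverse)
  have "l - h p \<in> order_ge (p + e)" for p
  proof (rule order_geI)
    fix m :: "'n \<Rightarrow>\<^sub>0 nat" assume m: "mdeg m < p + e"
    \<comment> \<open>Either of the two indices may be the larger one, so both iterates are compared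
      with the later one.\<close>
    have "mfps_nth (h (max p (Suc (mdeg m))) - h p) m = 0"
      using order_geD[OF step[of p "max p (Suc (mdeg m)) - p"] m] by simp
    moreover have "mfps_nth (h (max p (Suc (mdeg m))) - h (Suc (mdeg m))) m = 0"
      using order_geD[OF step[of "Suc (mdeg m)" "max p (Suc (mdeg m)) - Suc (mdeg m)"], of m] by simp
    ultimately show "mfps_nth (l - h p) m = 0" by (simp add: l)
  qed
  then show thesis by (rule that)
qed

text \<open>The correction \<open>h \<mapsto> h + (g - L h)\<close> improves an approximate preimage of \<open>g\<close> by one order.\<close>

lemma bij_if_unipotent:
  fixes L :: "('n::finite, 'a::comm_ring_1) mfps \<Rightarrow> ('n, 'a) mfps"
  assumes diff: "\<And>f g. L (f - g) = L f - L g"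
    and ord: "\<And>d r. r \<in> order_ge d \<Longrightarrow> L r - r \<in> order_ge (Suc d)"
  shows "bij L"
proof (rule bijI)
  have pres: "L r \<in> order_ge d" if "r \<in> order_ge d" for r d
    using order_ge_add[OF order_ge_mono[OF ord[OF that]] that] by simp
  show "inj L"
  proof (rule injI)
    fix f g assume "L f = L g"
    then have "L (f - g) = 0" by (simp add: diff)
    \<comment> \<open>If \<open>L r = 0\<close> then \<open>r = - (L r - r)\<close>, which has one
      order more than \<open>r\<close>.\<close>
    then have "f - g \<in> order_ge d" for d
    proof (induction d)
      case (Suc d)
      then show ?case using order_ge_minus[OF ord[OF Suc.IH]] by simp
    qed simp
    then show "f = g" by (rule order_ge_separated)
  qed
  show "surj L"
  proof (unfold surj_def, intro allI)
    fix g
    define h where "h = rec_nat 0 (\<lambda>_ h. h + (g - L h))"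
    have h_Suc: "h (Suc p) = h p + (g - L (h p))" for p
      by (simp add: h_def)
    have add: "L (f + g) = L f + L g" for f g
      using diff[of "f + g" g] by (simp add: algebra_simps)
    have approx: "g - L (h p) \<in> order_ge p" for p
    proof (induction p)
      case (Suc p)
      have "g - L (h (Suc p)) = - (L (g - L (h p)) - (g - L (h p)))"
        by (simp add: h_Suc add diff)
      then show ?case using order_ge_minus[OF ord[OF Suc]] by metis
    qed simp
    have "h (Suc p) - h p \<in> order_ge (p + 0)" for p
      by (simp add: h_Suc approx)
    then obtain l where l: "\<And>p. l - h p \<in> order_ge (p + 0)"
      using order_ge_complete[of h 0] by blast
    have "g - L l \<in> order_ge p" for p
      using order_ge_diff[OF approx[of p] pres[OF l[of p, simplified]]] by (simp add: diff)
    then have "g = L l" by (rule order_ge_separated)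
    then show "\<exists>x. g = L x" by blast
  qed
qed

text \<open>Multiplication by \<open>u\<close> is unipotent for the order filtration, hence
  surjective; a preimage of 1 is the inverse.\<close>

lemma unit_if_one_mod_order_ge:
  fixes u :: "('n::finite, 'a::comm_ring_1) mfps"
  assumes "u - 1 \<in> order_ge 1"
  shows "u dvd 1"
proof -
  have "bij ((*) u)"
  proof (rule bij_if_unipotent)
    show "u * r - r \<in> order_ge (Suc d)" if "r \<in> order_ge d" for r d
      using order_ge_mult[OF assms that] by (simp add: algebra_simps)
  qed (simp add: algebra_simps)
  then obtain v where "1 = u * v" by (metis bij_pointE)
  then show ?thesis by (rule dvdI)
qed

section \<open>Monomials and derivatives\<close>

definition mfps_monom :: "('n::finite \<Rightarrow>\<^sub>0 nat) \<Rightarrow> ('n, 'a::comm_ring_1) mfps" where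
  "mfps_monom a = Abs_mfps (\<lambda>m. if m = a then 1 else 0)"

lemma mfps_nth_monom: "mfps_nth (mfps_monom a) m = (if m = a then 1 else 0)"
  by (simp add: mfps_monom_def Abs_mfps_inverse)

lemma mfps_monom_0: "mfps_monom 0 = 1"
  by (rule mfps_eqI) (simp add: mfps_nth_monom mfps_nth_one)

lemma mfps_monom_single: "mfps_monom (Poly_Mapping.single i 1) = mfps_X i"
  by (rule mfps_eqI) (simp add: mfps_nth_monom mfps_X.rep_eq)

lemma mfps_monom_add:
  "mfps_monom (a + b) = (mfps_monom a * mfps_monom b :: ('n::finite, 'a::comm_ring_1) mfps)"
proof (rule mfps_eqI)
  fix m :: "'n \<Rightarrow>\<^sub>0 nat"
  have "mfps_nth (mfps_monom a * mfps_monom b ::('n, 'a) mfps) m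
      = (\<Sum>(x, y) \<in> {(x, y). x + y = m} \<inter> {(a, b)}. 1)"
    unfolding mfps_nth_mult
    by (rule sum.mono_neutral_cong_right)
      (auto simp: finite_splittings mfps_nth_monom split: if_splits)
  also have "\<dots> = mfps_nth (mfps_monom (a + b)) m"
    by (auto simp: mfps_nth_monom)
  finally show "mfps_nth (mfps_monom (a + b) ::('n, 'a) mfps) m = mfps_nth (mfps_monom a * mfps_monom b) m"
    by simp
qed

lemma mfps_monom_order_ge [simp]: "mfps_monom a \<in> order_ge (mdeg a)"
  by (rule order_geI) (auto simp: mfps_nth_monom)

lemma mfps_X_order_ge: "mfps_X i \<in> order_ge 1"
  using mfps_monom_order_ge[of "Poly_Mapping.single i 1"] unfolding mdeg_single mfps_monom_single .

lemma mfps_truncate: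
  "f - (\<Sum>a | mdeg a < M. mfps_scale (mfps_nth f a) (mfps_monom a)) \<in> order_ge M"
  by (rule order_geI) (simp add: mfps_nth_monom if_distrib cong: if_cong)

section \<open>Partial derivatives\<close>

lemma mfps_pderiv_add:
  fixes f g :: "('n::finite, 'a::comm_ring_1) mfps"
  shows "mfps_pderiv i (f + g) = mfps_pderiv i f + mfps_pderiv i g"
  by (rule mfps_eqI) (simp only: mfps_nth_pderiv mfps_nth_simps distrib_left)

lemma mfps_pderiv_scale:
  fixes f :: "('n::finite, 'a::comm_ring_1) mfps"
  shows "mfps_pderiv i (mfps_scale c f) = mfps_scale c (mfps_pderiv i f)"
  by (rule mfps_eqI) (simp only: mfps_nth_pderiv mfps_nth_simps mult.left_commute)

text \<open>For \<open>a + b = m + ?e\<close> the exponents of variable \<open>i\<close> in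
  \<open>a\<close> and \<open>b\<close> add up to the factor \<open>lookup m i + 1\<close>. This
  splits the convolution at \<open>m + ?e\<close> into two weighted sums, one for each summand of
  the product rule.\<close>

lemma mfps_pderiv_mult:
  fixes f g :: "('n::finite, 'a::comm_ring_1) mfps"
  shows "mfps_pderiv i (f * g) = mfps_pderiv i f * g + f * mfps_pderiv i g"
proof (rule mfps_eqI)
  fix m :: "'n \<Rightarrow>\<^sub>0 nat"
  let ?e = "Poly_Mapping.single i 1 :: 'n \<Rightarrow>\<^sub>0 nat"
  let ?S = "{(a, b). a + b = m + ?e}"
  \<comment> \<open>Splittings whose first part does not involve variable \<open>i\<close> have
    weight 0; the others are the splittings of \<open>m\<close> with \<open>?e\<close> added to the
    first part.\<close>
  have shift: "(\<Sum>(a, b) \<in> ?S. of_nat (Poly_Mapping.lookup a i) * mfps_nth f a * mfps_nth g b)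
      = mfps_nth (mfps_pderiv i f * g) m" for f g :: "('n, 'a) mfps"
  proof -
    have "(\<Sum>(a, b) \<in> ?S. of_nat (Poly_Mapping.lookup a i) * mfps_nth f a * mfps_nth g b)
        = (\<Sum>(a, b) \<in> (\<lambda>(a, b). (a + ?e, b)) ` {(a, b). a + b = m}.
              of_nat (Poly_Mapping.lookup a i) * mfps_nth f a * mfps_nth g b)"
    proof (rule sum.mono_neutral_right)
      show "finite ?S" by (rule finite_splittings)
      show "(\<lambda>(a, b). (a + ?e, b)) ` {(a, b). a + b = m} \<subseteq> ?S" by (auto simp: ac_simps)
      show "\<forall>x\<in>?S - (\<lambda>(a, b). (a + ?e, b)) ` {(a, b). a + b = m}.
          (case x of (a, b) \<Rightarrow> of_nat (Poly_Mapping.lookup a i) * mfps_nth f a * mfps_nth g b) = 0"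
      proof clarify
        fix a b assume ab: "a + b = m + ?e" "(a, b) \<notin> (\<lambda>(a, b). (a + ?e, b)) ` {(a, b). a + b = m}"
        have "Poly_Mapping.lookup a i = 0"
        proof (rule ccontr)
          assume "Poly_Mapping.lookup a i \<noteq> 0"
          then have "a = (a - ?e) + ?e"
            by (intro poly_mapping_eqI) (auto simp: lookup_add lookup_minus lookup_single when_def)
          then obtain a' where a': "a = a' + ?e" by blast
          with ab(1) have "(a' + b) + ?e = m + ?e" by (simp only: ac_simps)
          then have "a' + b = m" by (rule add_right_imp_eq)
          then have "(a, b) \<in> (\<lambda>(a, b). (a + ?e, b)) ` {(a, b). a + b = m}"
            by (intro image_eqI[of _ _ "(a', b)"]) (simp_all add: a')
          then show False using ab(2) by contradiction
        qed
        then show "of_nat (Poly_Mapping.lookup a i) * mfps_nth f a * mfps_nth g b = 0" by simp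
      qed
    qed
    also have "\<dots> = (\<Sum>(a, b) \<in> {(a, b). a + b = m}. mfps_nth (mfps_pderiv i f) a * mfps_nth g b)"
      by (subst sum.reindex)
        (auto simp: inj_on_def mfps_nth_pderiv lookup_add intro!: sum.cong)
    also have "\<dots> = mfps_nth (mfps_pderiv i f * g) m"
      by (simp only: mfps_nth_mult)
    finally show ?thesis .
  qed
  have "mfps_nth (mfps_pderiv i (f * g)) m
      = (\<Sum>(a, b) \<in> ?S. of_nat (Poly_Mapping.lookup a i) * mfps_nth f a * mfps_nth g b)
        + (\<Sum>(a, b) \<in> ?S. of_nat (Poly_Mapping.lookup b i) * mfps_nth g b * mfps_nth f a)"
  proof -
    have "of_nat (Poly_Mapping.lookup m i + 1) * (mfps_nth f a * mfps_nth g b)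
        = of_nat (Poly_Mapping.lookup a i) * mfps_nth f a * mfps_nth g b
          + of_nat (Poly_Mapping.lookup b i) * mfps_nth g b * mfps_nth f a" if "a + b = m + ?e" for a b
    proof -
      have "Poly_Mapping.lookup m i + 1 = Poly_Mapping.lookup a i + Poly_Mapping.lookup b i"
        using arg_cong[OF that, of "\<lambda>x. Poly_Mapping.lookup x i"] by (simp add: lookup_add)
      then show ?thesis by (simp only: of_nat_add algebra_simps)
    qed
    then show ?thesis
      unfolding mfps_nth_pderiv mfps_nth_mult sum_distrib_left sum.distrib[symmetric]
      by (intro sum.cong) auto
  qed
  also have "(\<Sum>(a, b) \<in> ?S. of_nat (Poly_Mapping.lookup b i) * mfps_nth g b * mfps_nth f a)
      = (\<Sum>(b, a) \<in> ?S. of_nat (Poly_Mapping.lookup b i) * mfps_nth g b * mfps_nth f a)"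
    by (rule sum.reindex_bij_witness[of _ prod.swap prod.swap]) (auto simp: add.commute)
  finally show "mfps_nth (mfps_pderiv i (f * g)) m
      = mfps_nth (mfps_pderiv i f * g + f * mfps_pderiv i g) m"
    by (simp only: shift mfps_nth_simps mult.commute[of f])
qed

lemma mfps_pderiv_X:
  "mfps_pderiv i (mfps_X j :: ('n::finite, 'a::comm_ring_1) mfps) = (if i = j then 1 else 0)"
proof (rule mfps_eqI)
  fix m :: "'n \<Rightarrow>\<^sub>0 nat"
  have "m + Poly_Mapping.single i 1 = Poly_Mapping.single j 1 \<longleftrightarrow> m = 0 \<and> i = j"
  proof
    assume eq: "m + Poly_Mapping.single i 1 = Poly_Mapping.single j 1"
    then have "mdeg m + 1 = 1" by (metis mdeg_add mdeg_single)
    then have "m = 0" by simp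
    with eq show "m = 0 \<and> i = j"
      by (metis add_0 lookup_single_eq lookup_single_not_eq zero_neq_one)
  qed simp
  then show "mfps_nth (mfps_pderiv i (mfps_X j)) m = mfps_nth (if i = j then 1 else (0 :: ('n, 'a) mfps)) m"
    by (auto simp: mfps_nth_pderiv mfps_X.rep_eq mfps_nth_one)
qed

lemma mfps_pderiv_1: "mfps_pderiv i 1 = 0"
  using mfps_pderiv_mult[of i 1 1] by simp

text \<open>Reduces estimates for linear maps to monomials: truncation below degree \<open>M\<close>
  leaves a finite combination of monomials, and \<open>cont\<close> handles the tail. When such a
  bound is available for every \<open>e\<close>, \<open>order_ge_separated\<close> turns it into an
  identity.\<close>

lemma order_ge_linear_bound:
  fixes R :: "('n::finite, 'a::comm_ring_1) mfps \<Rightarrow> ('n, 'a) mfps"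
  assumes add: "\<And>f g. R (f + g) = R f + R g"
    and scale: "\<And>c f. R (mfps_scale c f) = mfps_scale c (R f)"
    and cont: "\<And>h. h \<in> order_ge M \<Longrightarrow> R h \<in> order_ge e"
    and monom: "\<And>a. d \<le> mdeg a \<Longrightarrow> R (mfps_monom a) \<in> order_ge e"
    and f: "f \<in> order_ge d"
  shows "R f \<in> order_ge e"
proof -
  define t where "t a = mfps_scale (mfps_nth f a) (mfps_monom a)" for a
  have zero: "R 0 = 0" using add[of 0 0] by simp
  have "R (\<Sum>a\<in>A. t a) = (\<Sum>a\<in>A. R (t a))" for A
    by (induction A rule: infinite_finite_induct) (simp_all add: zero add)
  moreover have "R (t a) \<in> order_ge e" for a
  proof (cases "d \<le> mdeg a")
    case True
    then show ?thesis by (simp add: t_def scale order_ge_scale monom)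
  next
    case False
    then have "t a = 0" using order_geD[OF f, of a] by (intro mfps_eqI) (simp add: t_def)
    then show ?thesis by (simp add: zero)
  qed
  ultimately have "R (\<Sum>a | mdeg a < M. t a) \<in> order_ge e"
    by (simp add: order_ge_sum)
  moreover have "R (f - (\<Sum>a | mdeg a < M. t a)) \<in> order_ge e"
    unfolding t_def by (intro cont mfps_truncate)
  ultimately show ?thesis
    using order_ge_add add by (metis diff_add_cancel)
qed

section \<open>Substitution\<close>

definition mfps_pow :: "('n::finite \<Rightarrow> ('n, 'a::comm_ring_1) mfps) \<Rightarrow> ('n \<Rightarrow>\<^sub>0 nat) \<Rightarrow> ('n, 'a) mfps" where
  "mfps_pow y a = (\<Prod>i\<in>UNIV. y i ^ Poly_Mapping.lookup a i)"

lemma mfps_pow_add: "mfps_pow y (a + b) = mfps_pow y a * mfps_pow y b"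
  by (simp add: mfps_pow_def lookup_add power_add prod.distrib)

lemma mfps_pow_0: "mfps_pow y 0 = 1"
  by (simp add: mfps_pow_def)

lemma mfps_pow_single: "mfps_pow y (Poly_Mapping.single i 1) = y i"
proof -
  have "mfps_pow y (Poly_Mapping.single i 1) = (\<Prod>j\<in>UNIV. if j = i then y j else 1)"
    unfolding mfps_pow_def by (intro prod.cong) (auto simp: lookup_single when_def)
  then show ?thesis by simp
qed

lemma mfps_pow_order_ge: "(\<And>i. y i \<in> order_ge 1) \<Longrightarrow> mfps_pow y a \<in> order_ge (mdeg a)"
  unfolding mfps_pow_def mdeg_def by (intro order_ge_prod order_ge_power)

text \<open>The substitution \<open>f(y)\<close> makes sense if all \<open>y i\<close> have no constant term: then the monomials of
  degree greater than that of \<open>m\<close> do not contribute to the coefficient at \<open>m\<close>.\<close>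

definition mfps_subst :: "('n::finite \<Rightarrow> ('n, 'a::comm_ring_1) mfps) \<Rightarrow> ('n, 'a) mfps \<Rightarrow> ('n, 'a) mfps" where
  "mfps_subst y f = Abs_mfps (\<lambda>m. \<Sum>a | mdeg a < Suc (mdeg m). mfps_nth f a * mfps_nth (mfps_pow y a) m)"

lemma mfps_nth_subst:
  "mfps_nth (mfps_subst y f) m = (\<Sum>a | mdeg a < Suc (mdeg m). mfps_nth f a * mfps_nth (mfps_pow y a) m)"
  by (simp add: mfps_subst_def Abs_mfps_inverse)

lemma mfps_subst_add: "mfps_subst y (f + g) = mfps_subst y f + mfps_subst y g"
  by (rule mfps_eqI) (simp add: mfps_nth_subst distrib_right sum.distrib)

lemma mfps_subst_diff: "mfps_subst y (f - g) = mfps_subst y f - mfps_subst y g"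
  by (rule mfps_eqI) (simp add: mfps_nth_subst left_diff_distrib sum_subtractf)

lemma mfps_subst_scale: "mfps_subst y (mfps_scale c f) = mfps_scale c (mfps_subst y f)"
  by (rule mfps_eqI) (simp add: mfps_nth_subst sum_distrib_left)

lemma mfps_subst_order_ge: "f \<in> order_ge d \<Longrightarrow> mfps_subst y f \<in> order_ge d"
  by (rule order_geI) (simp add: mfps_nth_subst order_geD[of f d])

lemma mfps_subst_0: "mfps_subst y 0 = 0"
  by (rule mfps_eqI) (simp add: mfps_nth_subst)

lemma mfps_subst_monom:
  assumes "\<And>i. y i \<in> order_ge 1"
  shows "mfps_subst y (mfps_monom a) = mfps_pow y a"
proof (rule mfps_eqI)
  fix m
  have "mfps_nth (mfps_subst y (mfps_monom a)) m
      = (\<Sum>b | mdeg b < Suc (mdeg m). if b = a then mfps_nth (mfps_pow y b) m else 0)"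
    unfolding mfps_nth_subst by (intro sum.cong) (auto simp: mfps_nth_monom)
  \<comment> \<open>If \<open>a\<close> lies outside the range of summation, the sum is 0; so is the
    coefficient on the right, because \<open>mfps_pow y a\<close> has order at least
    \<open>mdeg a\<close>.\<close>
  also have "\<dots> = mfps_nth (mfps_pow y a) m"
    using order_geD[OF mfps_pow_order_ge[OF assms], of m a] by auto
  finally show "mfps_nth (mfps_subst y (mfps_monom a)) m = mfps_nth (mfps_pow y a) m" .
qed

lemma mfps_subst_1:
  assumes "\<And>i. y i \<in> order_ge 1"
  shows "mfps_subst y 1 = 1"
  using mfps_subst_monom[OF assms, where a = 0] by (simp add: mfps_monom_0 mfps_pow_0)

lemma mfps_subst_X:
  assumes "\<And>i. y i \<in> order_ge 1"
  shows "mfps_subst y (mfps_X i) = y i"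
  using mfps_subst_monom[OF assms, where a = "Poly_Mapping.single i 1"]
  unfolding mfps_monom_single mfps_pow_single .

lemma mfps_scale_mult_right:
  fixes f g :: "('n::finite, 'a::comm_ring_1) mfps"
  shows "mfps_scale c (f * g) = f * mfps_scale c g"
  using mfps_scale_mult_left[of c g f] by (simp add: mult.commute)

lemma mfps_scale_add:
  fixes f g :: "('n::finite, 'a::comm_ring_1) mfps"
  shows "mfps_scale c (f + g) = mfps_scale c f + mfps_scale c g"
    "mfps_scale c (f - g) = mfps_scale c f - mfps_scale c g"
  by (rule mfps_eqI, simp add: distrib_left right_diff_distrib)+

lemma mfps_scale_sum:
  fixes f :: "'b \<Rightarrow> ('n::finite, 'a::comm_ring_1) mfps"
  shows "mfps_scale c (sum f A) = (\<Sum>x\<in>A. mfps_scale c (f x))"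
  by (rule mfps_eqI) (simp add: sum_distrib_left)

text \<open>The defect of multiplicativity is bilinear, symmetric and continuous, and it vanishes on
  pairs of monomials. Modulo each \<open>order_ge d\<close> it therefore vanishes, first for one
  monomial argument and then for none.\<close>

lemma mfps_subst_mult:
  assumes y: "\<And>i. y i \<in> order_ge 1"
  shows "mfps_subst y (f * g) = mfps_subst y f * mfps_subst y g"
proof (rule order_ge_separated)
  fix d
  define R where "R f g = mfps_subst y (f * g) - mfps_subst y f * mfps_subst y g" for f g
  have comm: "R f g = R g f" for f g
    by (simp add: R_def mult.commute)
  have add: "R (f + f') g = R f g + R f' g" for f f' g
    by (simp add: R_def mfps_subst_add distrib_right)
  have scale: "R (mfps_scale c f) g = mfps_scale c (R f g)" for c f g
    by (simp add: R_def mfps_scale_add mfps_subst_scale flip: mfps_scale_mult_left)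
  have cont: "R f g \<in> order_ge d" if "f \<in> order_ge d" for f g
    unfolding R_def using that
    by (intro order_ge_diff mfps_subst_order_ge order_ge_mult_right)
  have monom: "R (mfps_monom a) (mfps_monom b) = 0" for a b
    by (simp add: R_def mfps_subst_monom[OF y] mfps_pow_add flip: mfps_monom_add)
  have monom': "R (mfps_monom a) g \<in> order_ge d" for a
    unfolding comm[of "mfps_monom a"]
    by (rule order_ge_linear_bound[where R = "\<lambda>g. R g (mfps_monom a)" and M = d and d = 0])
      (simp_all add: add scale cont monom)
  have "R f g \<in> order_ge d"
    by (rule order_ge_linear_bound[where R = "\<lambda>f. R f g" and M = d and d = 0])
      (simp_all add: add scale cont monom')
  then show "mfps_subst y (f * g) - mfps_subst y f * mfps_subst y g \<in> order_ge d"
    by (simp add: R_def)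
qed

lemma mfps_pow_X: "mfps_pow mfps_X a = mfps_monom a"
  by (induction a rule: exponent_induct)
    (simp_all only: mfps_pow_0 mfps_monom_0 mfps_pow_add mfps_monom_add mfps_pow_single mfps_monom_single)

lemma mfps_subst_X_id: "mfps_subst mfps_X f = f"
proof (rule order_ge_separated)
  fix d
  show "mfps_subst mfps_X f - f \<in> order_ge d"
    by (rule order_ge_linear_bound[where R = "\<lambda>f. mfps_subst mfps_X f - f" and M = d and d = 0])
      (simp_all add: mfps_subst_add mfps_subst_scale mfps_scale_add mfps_subst_order_ge order_ge_diff
        mfps_subst_monom mfps_X_order_ge[unfolded One_nat_def] mfps_pow_X)
qed

text \<open>The exponents are arranged so that no subtraction occurs: an increment of order \<open>s + 1\<close> raises
  the order \<open>d\<close> of \<open>f\<close> by \<open>s\<close> in the linear term and by \<open>2 * s\<close> in the remainder, which makes the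
  estimate multiplicative in \<open>f\<close> also for \<open>d = 0\<close>.\<close>

lemma mfps_subst_taylor:
  fixes f :: "('n::finite, 'a::comm_ring_1) mfps"
  assumes y: "\<And>i. y i \<in> order_ge 1" and c: "\<And>i. c i \<in> order_ge (Suc s)" and f: "f \<in> order_ge d"
  shows "mfps_subst (\<lambda>i. y i + c i) f - mfps_subst y f
      - (\<Sum>i\<in>UNIV. c i * mfps_subst y (mfps_pderiv i f)) \<in> order_ge (2 * s + d)" (is ?taylor)
    and "(\<Sum>i\<in>UNIV. c i * mfps_subst y (mfps_pderiv i f)) \<in> order_ge (s + d)" (is ?linear)
proof -
  define z where "z = (\<lambda>i. y i + c i)"
  have z: "z i \<in> order_ge 1" for i
    unfolding z_def using order_ge_mono[OF c, of 1] by (intro order_ge_add y) simp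
  \<comment> \<open>\<open>D\<close> is the linear term of the Taylor expansion, a derivation along
    \<open>mfps_subst y\<close>, and \<open>R\<close> is the remainder.\<close>
  define D where "D f = (\<Sum>i\<in>UNIV. c i * mfps_subst y (mfps_pderiv i f))" for f
  define R where "R f = mfps_subst z f - mfps_subst y f - D f" for f
  have D_add: "D (f + g) = D f + D g" for f g
    by (simp add: D_def mfps_pderiv_add mfps_subst_add distrib_left sum.distrib)
  have D_scale: "D (mfps_scale b f) = mfps_scale b (D f)" for b f
    by (simp add: D_def mfps_pderiv_scale mfps_subst_scale mfps_scale_sum flip: mfps_scale_mult_right)
  have D_mult: "D (f * g) = mfps_subst y f * D g + D f * mfps_subst y g" for f g
    by (simp add: D_def mfps_pderiv_mult mfps_subst_add mfps_subst_mult[OF y] sum_distrib_left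
        sum_distrib_right distrib_left sum.distrib ac_simps
        del: ideal.scale_scale)
  \<comment> \<open>Differentiation loses one order; \<open>c\<close>, of order
    \<open>s + 1\<close>, restores it and adds \<open>s\<close>.\<close>
  have D_ord: "D f \<in> order_ge (s + d)" if "f \<in> order_ge d" for f d
    unfolding D_def
    by (intro order_ge_sum order_ge_mult_le[OF c mfps_subst_order_ge[OF pderiv_order_ge[OF that]]]) simp
  then show ?linear using f by (simp add: D_def)
  have R_mult: "R (f * g) \<in> order_ge (2 * s + (d + e))"
    if f: "f \<in> order_ge d" "R f \<in> order_ge (2 * s + d)" and g: "g \<in> order_ge e" "R g \<in> order_ge (2 * s + e)"
    for f g d e
  proof -
    \<comment> \<open>Substitute \<open>f(z) = f(y) + D f + R f\<close>, and likewise for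
      \<open>g\<close>. Besides multiples of remainders only \<open>D f * D g\<close> is left, which
      is quadratic in the increment.\<close>
    have "R (f * g) = mfps_subst z f * R g + R f * (mfps_subst y g + D g) + D f * D g"
      by (simp add: R_def D_mult mfps_subst_mult[OF y] mfps_subst_mult[OF z] algebra_simps
          del: ideal.scale_scale)
    also have "\<dots> \<in> order_ge (2 * s + (d + e))"
    proof (intro order_ge_add)
      show "mfps_subst z f * R g \<in> order_ge (2 * s + (d + e))"
        by (rule order_ge_mult_le[OF mfps_subst_order_ge[OF f(1)] g(2)]) simp
      have "mfps_subst y g + D g \<in> order_ge e"
        using order_ge_mono[OF D_ord[OF g(1)]] by (intro order_ge_add mfps_subst_order_ge g(1)) simp
      from order_ge_mult_le[OF f(2) this] show "R f * (mfps_subst y g + D g) \<in> order_ge (2 * s + (d + e))"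
        by simp
      show "D f * D g \<in> order_ge (2 * s + (d + e))"
        by (rule order_ge_mult_le[OF D_ord[OF f(1)] D_ord[OF g(1)]]) simp
    qed
    finally show ?thesis .
  qed
  have R_X: "R (mfps_X i) = 0" for i
  proof -
    have "D (mfps_X i) = (\<Sum>j\<in>UNIV. if j = i then c j else 0)"
      unfolding D_def
      by (intro sum.cong) (auto simp: mfps_pderiv_X mfps_subst_1[OF y] mfps_subst_0)
    then show ?thesis using mfps_subst_X[OF z, where i = i] by (simp add: R_def mfps_subst_X[OF y] z_def)
  qed
  have R_1: "R 1 = 0"
    by (simp add: R_def D_def mfps_pderiv_1 mfps_subst_1[OF y] mfps_subst_1[OF z]
        mfps_subst_0)
  have R_monom: "R (mfps_monom a) \<in> order_ge (2 * s + mdeg a)" for a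
  proof (induction a rule: exponent_induct)
    case zero
    then show ?case by (simp add: mfps_monom_0 R_1)
  next
    case (add m i)
    show ?case
      unfolding mfps_monom_add mfps_monom_single mdeg_add mdeg_single
      by (rule R_mult) (simp_all add: add R_X mfps_X_order_ge[unfolded One_nat_def])
  qed
  have "R f \<in> order_ge (2 * s + d)"
  proof (rule order_ge_linear_bound[where R = R and M = "2 * s + d" and d = d])
    show "R (f + g) = R f + R g" for f g
      by (simp add: R_def mfps_subst_add D_add)
    show "R (mfps_scale b f) = mfps_scale b (R f)" for b f
      by (simp add: R_def mfps_subst_scale D_scale mfps_scale_add)
    show "R h \<in> order_ge (2 * s + d)" if "h \<in> order_ge (2 * s + d)" for h
      unfolding R_def using order_ge_mono[OF D_ord[OF that]]
      by (intro order_ge_diff mfps_subst_order_ge that) simp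
    show "R (mfps_monom a) \<in> order_ge (2 * s + d)" if "d \<le> mdeg a" for a
      using order_ge_mono[OF R_monom] that by simp
    show "f \<in> order_ge d" by (rule f)
  qed
  then show ?taylor by (simp add: R_def D_def z_def)
qed

section \<open>Coordinate changes as automorphisms\<close>

lemma mfps_subst_increment_order_ge:
  assumes y: "\<And>i. y i \<in> order_ge 1" and c: "\<And>i. c i \<in> order_ge (Suc s)" and f: "f \<in> order_ge d"
  shows "mfps_subst (\<lambda>i. y i + c i) f - mfps_subst y f \<in> order_ge (s + d)"
  using order_ge_add[OF order_ge_mono[OF mfps_subst_taylor(1)[of y c s f d, OF assms], of "s + d"]
      mfps_subst_taylor(2)[of y c s f d, OF assms]] by simp

text \<open>An increment of order 2 changes every series by terms of one order more, so the
  substitution is unipotent and \<open>bij_if_unipotent\<close> replaces an inverse function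
  theorem.\<close>

lemma mfps_automorphism_subst:
  fixes b :: "'n \<Rightarrow> ('n::finite, 'k::field) mfps"
  assumes "\<And>i. b i \<in> order_ge 2"
  shows "mfps_automorphism (mfps_subst (\<lambda>i. mfps_X i + b i))"
proof -
  let ?y = "\<lambda>i. mfps_X i + b i"
  have y: "?y i \<in> order_ge 1" for i
    using order_ge_mono[OF assms, of 1] by (intro order_ge_add mfps_X_order_ge) simp
  have "bij (mfps_subst ?y)"
  proof (rule bij_if_unipotent)
    show "mfps_subst ?y r - r \<in> order_ge (Suc d)" if "r \<in> order_ge d" for r d
      using mfps_subst_increment_order_ge[of mfps_X b 1 r d] assms that
      by (simp add: mfps_X_order_ge[unfolded One_nat_def] mfps_subst_X_id numeral_2_eq_2)
  qed (rule mfps_subst_diff)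
  moreover have "Vector_Spaces.linear mfps_scale mfps_scale (mfps_subst ?y)"
    by unfold_locales (simp_all add: mfps_subst_add mfps_subst_scale)
  ultimately show ?thesis
    by (simp add: mfps_automorphism_def mfps_subst_1[OF y] mfps_subst_mult[OF y])
qed

text \<open>The iteration carries \<open>f\<close> to \<open>g\<close>, whereas both equivalences
  ask for \<open>f\<close> as an image of \<open>g\<close>.\<close>

lemma mfps_automorphism_inv:
  assumes "mfps_automorphism \<phi>"
  shows "mfps_automorphism (inv \<phi>)"
proof -
  have bij: "bij \<phi>" and lin: "Vector_Spaces.linear mfps_scale mfps_scale \<phi>" and one: "\<phi> 1 = 1"
    and mult: "\<And>f g. \<phi> (f * g) = \<phi> f * \<phi> g"
    using assms by (auto simp: mfps_automorphism_def)
  interpret \<phi>: Vector_Spaces.linear mfps_scale mfps_scale \<phi> by (rule lin)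
  have inv: "\<phi> (inv \<phi> x) = x" "inv \<phi> (\<phi> x) = x" for x
    using bij by (simp_all add: bij_is_surj surj_f_inv_f bij_is_inj)
  have eqI: "inv \<phi> x = y" if "x = \<phi> y" for x y
    using that inv by simp
  have "inv \<phi> (f + g) = inv \<phi> f + inv \<phi> g" for f g
    by (rule eqI) (simp add: \<phi>.add inv)
  moreover have "inv \<phi> (mfps_scale c f) = mfps_scale c (inv \<phi> f)" for c f
    by (rule eqI) (simp add: \<phi>.scale inv)
  ultimately have "Vector_Spaces.linear mfps_scale mfps_scale (inv \<phi>)"
    by unfold_locales auto
  moreover have "inv \<phi> 1 = 1"
    by (rule eqI) (simp add: one)
  moreover have "inv \<phi> (f * g) = inv \<phi> f * inv \<phi> g" for f g
    by (rule eqI) (simp add: mult inv)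
  ultimately show ?thesis
    using bij by (simp add: mfps_automorphism_def bij_imp_bij_inv)
qed

section \<open>Approximation modulo the Jacobian and Tjurina ideals\<close>

text \<open>Otherwise one could pick \<open>h i \<in> order_ge i\<close> outside \<open>I + order_ge (i + 1)\<close> for all
  \<open>i \<le> card B\<close>; by considering the term of lowest index, these are independent modulo \<open>I\<close>.\<close>

lemma basis_mod_order_ge_absorbed:
  fixes I :: "('n::finite, 'k::field) mfps set"
  assumes I: "mfps_vs.subspace I" and B: "basis_mod I B"
  obtains i where "i \<le> card B" "\<And>h. h \<in> order_ge i \<Longrightarrow> \<exists>j\<in>I. h - j \<in> order_ge (Suc i)"
proof (rule ccontr)
  define k where "k = card B"
  assume "\<not> thesis"
  then have "\<forall>i. \<exists>h. i \<le> k \<longrightarrow> h \<in> order_ge i \<and> (\<forall>j\<in>I. h - j \<notin> order_ge (Suc i))"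
    using that unfolding k_def by blast
  then obtain h where h: "\<And>i. i \<le> k \<Longrightarrow> h i \<in> order_ge i"
    and h_notin: "\<And>i j. i \<le> k \<Longrightarrow> j \<in> I \<Longrightarrow> h i - j \<notin> order_ge (Suc i)"
    by metis
  \<comment> \<open>Replacing each \<open>h i\<close> by a representative in the span of
    \<open>B\<close> lets the number of independent elements be bounded by
    \<open>card B\<close>.\<close>
  have "\<exists>v. v \<in> mfps_vs.span B \<and> h i - v \<in> I" for i
  proof -
    obtain c where "h i - (\<Sum>b\<in>B. mfps_scale (c b) b) \<in> I"
      using B unfolding basis_mod_def by blast
    moreover have "(\<Sum>b\<in>B. mfps_scale (c b) b) \<in> mfps_vs.span B"
      by (intro mfps_vs.span_sum mfps_vs.span_scale mfps_vs.span_base)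
    ultimately show ?thesis by blast
  qed
  then obtain v where v: "\<And>i. v i \<in> mfps_vs.span B" "\<And>i. h i - v i \<in> I"
    by metis
  \<comment> \<open>\<open>W i\<close> is the subspace \<open>I + m^(i+1)\<close>.\<close>
  define W where "W i = {x. \<exists>j\<in>I. x - j \<in> order_ge (Suc i)}" for i
  have W: "mfps_vs.subspace (W i)" for i
  proof (rule mfps_vs.subspaceI)
    show "0 \<in> W i"
      using mfps_vs.subspace_0[OF I] unfolding W_def by (intro CollectI bexI[of _ 0]) simp_all
    show "x + y \<in> W i" if xy: "x \<in> W i" "y \<in> W i" for x y
    proof -
      obtain j j' where "j \<in> I" "x - j \<in> order_ge (Suc i)" "j' \<in> I" "y - j' \<in> order_ge (Suc i)"
        using xy by (auto simp: W_def)
      then have "j + j' \<in> I" "x + y - (j + j') \<in> order_ge (Suc i)"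
        using mfps_vs.subspace_add[OF I] order_ge_add by (auto simp: add_diff_add)
      then show ?thesis by (auto simp: W_def)
    qed
    show "mfps_scale c x \<in> W i" if x: "x \<in> W i" for c x
    proof -
      obtain j where j: "j \<in> I" "x - j \<in> order_ge (Suc i)"
        using x by (auto simp: W_def)
      have "mfps_scale c x - mfps_scale c j \<in> order_ge (Suc i)"
        using order_ge_scale[OF j(2)] by (simp add: mfps_scale_add)
      then show ?thesis
        using mfps_vs.subspace_scale[OF I j(1)] by (auto simp: W_def)
    qed
  qed
  \<comment> \<open>\<open>S n\<close> collects the representatives of the \<open>n\<close> highest
    indices up to \<open>k\<close>. Each induction step adds the next lower index \<open>i\<close>:
    all earlier elements lie in \<open>W i\<close>, the new one does not.\<close>
  define S where "S n = v ` {i. i \<le> k \<and> k < i + n}" for n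
  have "mfps_vs.independent (S n) \<and> card (S n) = n" if "n \<le> Suc k" for n
    using that
  proof (induction n)
    case 0
    have "S 0 = {}" by (auto simp: S_def)
    then show ?case by (simp add: mfps_vs.independent_empty)
  next
    case (Suc n)
    define i where "i = k - n"
    have i: "i \<le> k" "k = i + n" using Suc.prems by (auto simp: i_def)
    have "{l. l \<le> k \<and> k < l + Suc n} = insert i {l. l \<le> k \<and> k < l + n}"
      using i by auto
    then have S: "S (Suc n) = insert (v i) (S n)"
      by (simp add: S_def)
    have "v l \<in> W i" if l: "l \<le> k" "k < l + n" for l
    proof -
      have "v l - h l \<in> I"
        using mfps_vs.subspace_neg[OF I v(2)[of l]] by simp
      moreover have "v l - (v l - h l) \<in> order_ge (Suc i)"
        using order_ge_mono[OF h[OF l(1)], of "Suc i"] i l by simp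
      ultimately show ?thesis
        unfolding W_def by blast
    qed
    then have "mfps_vs.span (S n) \<subseteq> W i"
      by (intro mfps_vs.span_minimal W) (auto simp: S_def)
    moreover have "v i \<notin> W i"
    proof
      assume "v i \<in> W i"
      then obtain j where j: "j \<in> I" "v i - j \<in> order_ge (Suc i)"
        by (auto simp: W_def)
      have "j + (h i - v i) \<in> I"
        by (rule mfps_vs.subspace_add[OF I j(1) v(2)])
      from h_notin[OF i(1) this] j(2) show False by (simp add: algebra_simps)
    qed
    ultimately have "v i \<notin> mfps_vs.span (S n)" by blast
    moreover have "finite (S n)" by (simp add: S_def)
    ultimately show ?case
      using Suc mfps_vs.span_base[of "v i" "S n"] by (auto simp: S mfps_vs.independent_insert)
  qed
  from this[of "Suc k"] have ind: "mfps_vs.independent (S (Suc k))" "card (S (Suc k)) = Suc k"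
    by auto
  have "S (Suc k) \<subseteq> mfps_vs.span B"
    using v(1) by (auto simp: S_def)
  moreover have "finite B"
    using B by (simp add: basis_mod_def)
  ultimately have "Suc k \<le> k"
    using mfps_vs.independent_span_bound[OF _ ind(1)] ind(2) by (simp add: k_def)
  then show False by simp
qed

text \<open>Coefficients are indexed by variables and not by generators, so coinciding derivatives
  cause no trouble.\<close>

lemma ideal_gen_insert_rangeD:
  fixes F :: "'n::finite \<Rightarrow> 'r::comm_ring_1"
  assumes "h \<in> ideal_gen (insert f (range F))"
  obtains a c where "h = a * f + (\<Sum>j\<in>UNIV. c j * F j)"
proof -
  let ?J = "{a * f + (\<Sum>j\<in>UNIV. c j * F j) | a c. True}"
  have "h \<in> ?J"
    using assms
  proof (induction rule: ideal.span_induct_alt)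
    case base
    show ?case by (intro CollectI exI[of _ 0] exI[of _ "\<lambda>_. 0"]) simp
  next
    case (step x s t)
    from step(2) obtain a c where t: "t = a * f + (\<Sum>j\<in>UNIV. c j * F j)" by blast
    from step(1) consider "s = f" | l where "s = F l" by blast
    then show ?case
    proof cases
      case 1
      then have "x * s + t = (x + a) * f + (\<Sum>j\<in>UNIV. c j * F j)"
        by (simp add: t distrib_right)
      then show ?thesis by blast
    next
      case 2
      have "(\<Sum>j\<in>UNIV. (c j + (if j = l then x else 0)) * F j) = (\<Sum>j\<in>UNIV. c j * F j) + x * F l"
        by (simp add: distrib_right sum.distrib if_distrib[of "\<lambda>x. x * _"] cong: if_cong)
      then have "x * s + t = a * f + (\<Sum>j\<in>UNIV. (c j + (if j = l then x else 0)) * F j)"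
        by (simp add: t 2 add.commute add.left_commute)
      then show ?thesis
        by (intro CollectI exI[of _ a] exI[of _ "\<lambda>j. c j + (if j = l then x else 0)"]) simp
    qed
  qed
  then show thesis using that by blast
qed

text \<open>The flag \<open>con\<close> distinguishes contact equivalence, where multiples of \<open>f\<close> itself may be used,
  from right equivalence.\<close>

lemma approximation_shift:
  fixes f :: "('n::finite, 'a::comm_ring_1) mfps" and F :: "'n \<Rightarrow> ('n, 'a) mfps"
  assumes base: "\<And>h. h \<in> order_ge i \<Longrightarrow>
      \<exists>a c. (con \<or> a = 0) \<and> h - (a * f + (\<Sum>j\<in>UNIV. c j * F j)) \<in> order_ge (Suc i)"
    and h: "h \<in> order_ge (i + e)"
  obtains a c where "con \<or> a = 0" "a \<in> order_ge e" "\<And>j. c j \<in> order_ge e"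
    "h - (a * f + (\<Sum>j\<in>UNIV. c j * F j)) \<in> order_ge (Suc (i + e))"
proof -
  \<comment> \<open>\<open>P\<close> is additive and holds for products of a series of order
    \<open>e\<close> with one of order \<open>i\<close>, by multiplying the approximation from
    \<open>base\<close>. Up to a tail that is already small enough, \<open>h\<close> is a finite sum
    of such products.\<close>
  define P where "P h \<longleftrightarrow> (\<exists>a c. (con \<or> a = 0) \<and> a \<in> order_ge e \<and> (\<forall>j. c j \<in> order_ge e) \<and>
      h - (a * f + (\<Sum>j\<in>UNIV. c j * F j)) \<in> order_ge (Suc (i + e)))" for h
  have P_small: "P h" if "h \<in> order_ge (Suc (i + e))" for h
    unfolding P_def using that by (intro exI[of _ 0] exI[of _ "\<lambda>_. 0"]) simp
  have P_add: "P (h + h')" if "P h" "P h'" for h h'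
  proof -
    obtain a c where ac: "con \<or> a = 0" "a \<in> order_ge e" "\<And>j. c j \<in> order_ge e"
      "h - (a * f + (\<Sum>j\<in>UNIV. c j * F j)) \<in> order_ge (Suc (i + e))"
      using \<open>P h\<close> unfolding P_def by blast
    obtain a' c' where ac': "con \<or> a' = 0" "a' \<in> order_ge e" "\<And>j. c' j \<in> order_ge e"
      "h' - (a' * f + (\<Sum>j\<in>UNIV. c' j * F j)) \<in> order_ge (Suc (i + e))"
      using \<open>P h'\<close> unfolding P_def by blast
    have "h + h' - ((a + a') * f + (\<Sum>j\<in>UNIV. (c j + c' j) * F j))
        = (h - (a * f + (\<Sum>j\<in>UNIV. c j * F j))) + (h' - (a' * f + (\<Sum>j\<in>UNIV. c' j * F j)))"
      by (simp add: distrib_right sum.distrib)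
    also have "\<dots> \<in> order_ge (Suc (i + e))"
      by (rule order_ge_add[OF ac(4) ac'(4)])
    finally show ?thesis
      unfolding P_def using ac ac'
      by (intro exI[of _ "a + a'"] exI[of _ "\<lambda>j. c j + c' j"]) (auto intro: order_ge_add)
  qed
  have P_mult: "P (x * h)" if h: "h \<in> order_ge i" and x: "x \<in> order_ge e" for x h
  proof -
    obtain a c where ac: "con \<or> a = 0" "h - (a * f + (\<Sum>j\<in>UNIV. c j * F j)) \<in> order_ge (Suc i)"
      using base[OF h] by blast
    have "x * h - (x * a * f + (\<Sum>j\<in>UNIV. x * c j * F j)) = x * (h - (a * f + (\<Sum>j\<in>UNIV. c j * F j)))"
      by (simp add: right_diff_distrib distrib_left sum_distrib_left)
    also have "\<dots> \<in> order_ge (Suc (i + e))"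
      by (rule order_ge_mult_le[OF x ac(2)]) simp
    finally show ?thesis
      unfolding P_def using ac x
      by (intro exI[of _ "x * a"] exI[of _ "\<lambda>j. x * c j"]) (auto intro: order_ge_mult_right)
  qed
  define t where "t m = mfps_scale (mfps_nth h m) (mfps_monom m)" for m
  have P_t: "P (t m)" for m
  proof (cases "i + e \<le> mdeg m")
    case True
    \<comment> \<open>The factor \<open>b'\<close> of degree exactly \<open>i\<close> goes to
      \<open>base\<close>; the cofactor \<open>b\<close> supplies the order \<open>e\<close> of the
      coefficients.\<close>
    then obtain b b' where m: "m = b + b'" "mdeg b' = i" "e \<le> mdeg b"
      using exponent_split[of i m] by (metis add_leD1 add_le_cancel_left mdeg_add add.commute)
    then have "t m = mfps_scale (mfps_nth h m) (mfps_monom b) * mfps_monom b'"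
      by (simp add: t_def mfps_monom_add mfps_scale_mult_left)
    moreover have "P \<dots>"
      using m order_ge_mono[OF mfps_monom_order_ge m(3)]
      by (intro P_mult order_ge_scale) (auto intro: order_ge_mono[OF mfps_monom_order_ge])
    ultimately show ?thesis by simp
  next
    case False
    then have "t m = 0"
      using order_geD[OF h, of m] by (intro mfps_eqI) (simp add: t_def)
    then show ?thesis by (simp add: P_small)
  qed
  have "P (\<Sum>m\<in>A. t m)" for A
    by (induction A rule: infinite_finite_induct) (simp_all add: P_small P_add P_t)
  moreover have "P (h - (\<Sum>m | mdeg m < Suc (i + e). t m))"
    unfolding t_def by (rule P_small[OF mfps_truncate])
  ultimately have "P h"
    using P_add by (metis diff_add_cancel)
  then show thesis
    using that unfolding P_def by blast
qed

section \<open>Determinacy\<close>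

text \<open>One Newton step. The residual of order \<open>i + (s + 1 + p)\<close> is expressed by
  \<open>f\<close> and its derivatives with coefficients \<open>a\<close>, \<open>c\<close> of order
  \<open>s + 1 + p\<close>, and these serve as the corrections.\<close>

lemma equivalence_step:
  fixes f :: "('n::finite, 'a::comm_ring_1) mfps"
  assumes f: "f \<in> order_ge d" and s: "s + d = i + 2" and d: "1 \<le> d"
    and base: "\<And>h. h \<in> order_ge i \<Longrightarrow> \<exists>a c. (con \<or> a = 0) \<and>
        h - (a * f + (\<Sum>j\<in>UNIV. c j * mfps_pderiv j f)) \<in> order_ge (Suc i)"
    and u: "u - 1 \<in> order_ge (Suc s)" and b: "\<And>j. b j \<in> order_ge (Suc s)"
    and approx: "u * mfps_subst (\<lambda>j. mfps_X j + b j) f - g \<in> order_ge (i + (Suc s + p))"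
  obtains a c where "con \<or> a = 0" "a \<in> order_ge (Suc s + p)" "\<And>j. c j \<in> order_ge (Suc s + p)"
    "(u + a) * mfps_subst (\<lambda>j. mfps_X j + (b j + c j)) f - g \<in> order_ge (Suc (i + (Suc s + p)))"
proof -
  define y where "y = (\<lambda>j. mfps_X j + b j)"
  define A where "A = mfps_subst y f"
  have "g - u * A \<in> order_ge (i + (Suc s + p))"
    using order_ge_minus[OF approx] by (simp add: A_def y_def)
  then obtain a c where a: "con \<or> a = 0" "a \<in> order_ge (Suc s + p)"
    and c: "\<And>j. c j \<in> order_ge (Suc s + p)"
    and r: "g - u * A - (a * f + (\<Sum>j\<in>UNIV. c j * mfps_pderiv j f)) \<in> order_ge (Suc (i + (Suc s + p)))"
    using approximation_shift[OF base] by blast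
  have c': "c j \<in> order_ge (Suc (s + p))" for j
    using c[of j] by simp
  have bc: "b j + c j \<in> order_ge (Suc s)" for j
    using order_ge_mono[OF c[of j]] by (intro order_ge_add b) simp
  have X: "mfps_X j \<in> order_ge 1" for j :: 'n
    by (rule mfps_X_order_ge)
  have y: "y j \<in> order_ge 1" for j
    unfolding y_def using order_ge_mono[OF b] by (intro order_ge_add X) simp
  define A' where "A' = mfps_subst (\<lambda>j. mfps_X j + (b j + c j)) f"
  define D where "D = (\<Sum>j\<in>UNIV. c j * mfps_subst y (mfps_pderiv j f))"
  have R: "A' - A - D \<in> order_ge (2 * (s + p) + d)" and D: "D \<in> order_ge (s + p + d)"
    using mfps_subst_taylor[of y c, OF y c' f] by (simp_all add: A_def A'_def D_def y_def add.assoc)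
  have A'_f: "A' - f \<in> order_ge (s + d)"
    using mfps_subst_increment_order_ge[of mfps_X "\<lambda>j. b j + c j", OF X bc f] by (simp add: A'_def mfps_subst_X_id)
  have pderiv: "mfps_subst y (mfps_pderiv j f) - mfps_pderiv j f \<in> order_ge (s + (d - 1))" for j
    using mfps_subst_increment_order_ge[of mfps_X b, OF X b pderiv_order_ge[OF f]]
    by (simp add: y_def mfps_subst_X_id)
  \<comment> \<open>The new residual collects the errors of the linearization: using
    \<open>f\<close> for \<open>A'\<close>, the Taylor remainder, using 1 for \<open>u\<close>,
    taking derivatives at \<open>x\<close> and not at \<open>y\<close>, and the approximation error
    \<open>r\<close>.\<close>
  have "(u + a) * A' - g
      = a * (A' - f) + u * (A' - A - D) + (u - 1) * D
        + (\<Sum>j\<in>UNIV. c j * (mfps_subst y (mfps_pderiv j f) - mfps_pderiv j f))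
        - (g - u * A - (a * f + (\<Sum>j\<in>UNIV. c j * mfps_pderiv j f)))"
    by (simp add: D_def sum_subtractf algebra_simps del: ideal.scale_scale)
  also have "\<dots> \<in> order_ge (Suc (i + (Suc s + p)))"
  proof (intro order_ge_diff[OF _ r] order_ge_add order_ge_sum)
    show "a * (A' - f) \<in> order_ge (Suc (i + (Suc s + p)))"
      by (rule order_ge_mult_le[OF a(2) A'_f]) (use s in simp)
    \<comment> \<open>The order \<open>2 * (s + p) + d\<close> equals
      \<open>i + 2 + s + 2 * p\<close>, which is just enough for \<open>p = 0\<close>.\<close>
    show "u * (A' - A - D) \<in> order_ge (Suc (i + (Suc s + p)))"
      by (intro order_ge_mult_left order_ge_mono[OF R]) (use s in simp)
    show "(u - 1) * D \<in> order_ge (Suc (i + (Suc s + p)))"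
      by (rule order_ge_mult_le[OF u D]) (use s in simp)
    \<comment> \<open>The orders \<open>s + 1 + p\<close> and \<open>s + d - 1\<close> add up to
      exactly the required \<open>i + s + p + 2\<close>; this dictates the choice of
      \<open>s\<close>.\<close>
    show "c j * (mfps_subst y (mfps_pderiv j f) - mfps_pderiv j f) \<in> order_ge (Suc (i + (Suc s + p)))" for j
      by (rule order_ge_mult_le[OF c pderiv]) (use s d in simp)
  qed
  finally show thesis
    using that[OF a c] by (simp add: A'_def)
qed

text \<open>Dependent choice iterates the Newton step. The increments at stage \<open>p\<close> have
  order \<open>p + s + 1\<close>, so \<open>u\<close> and \<open>b\<close> converge;
  \<open>s >= 1\<close> gives the limit of \<open>b\<close> order 2.\<close>

lemma exists_equivalence:
  fixes f :: "('n::finite, 'a::comm_ring_1) mfps"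
  assumes f: "f \<in> order_ge d" and s: "s + d = i + 2" "1 \<le> s" and d: "1 \<le> d"
    and base: "\<And>h. h \<in> order_ge i \<Longrightarrow> \<exists>a c. (con \<or> a = 0) \<and>
        h - (a * f + (\<Sum>j\<in>UNIV. c j * mfps_pderiv j f)) \<in> order_ge (Suc i)"
    and g: "f - g \<in> order_ge (i + Suc s)"
  obtains u b where "con \<or> u = 1" "u - 1 \<in> order_ge 1" "\<And>j. b j \<in> order_ge 2"
    "u * mfps_subst (\<lambda>j. mfps_X j + b j) f = g"
proof -
  define good where "good p ub \<longleftrightarrow> (case ub of (u, b) \<Rightarrow> (con \<or> u = 1) \<and> u - 1 \<in> order_ge (Suc s)
      \<and> (\<forall>j. b j \<in> order_ge (Suc s))
      \<and> u * mfps_subst (\<lambda>j. mfps_X j + b j) f - g \<in> order_ge (i + (Suc s + p)))"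
    for p and ub :: "('n, 'a) mfps \<times> ('n \<Rightarrow> ('n, 'a) mfps)"
  define close where "close p ub ub' \<longleftrightarrow> (case (ub, ub') of ((u, b), (u', b')) \<Rightarrow>
      u' - u \<in> order_ge (p + Suc s) \<and> (\<forall>j. b' j - b j \<in> order_ge (p + Suc s)))"
    for p and ub ub' :: "('n, 'a) mfps \<times> ('n \<Rightarrow> ('n, 'a) mfps)"
  have "\<exists>ub. \<forall>p. good p (ub p) \<and> close p (ub p) (ub (Suc p))"
  proof (rule dependent_nat_choice)
    \<comment> \<open>The iteration starts at the identity, with residual
      \<open>f - g\<close>.\<close>
    show "\<exists>ub. good 0 ub"
      using g by (intro exI[of _ "(1, \<lambda>_. 0)"]) (simp add: good_def mfps_subst_X_id)
    fix ub p assume "good p ub"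
    obtain u b where ub: "ub = (u, b)" by (cases ub)
    have u: "con \<or> u = 1" "u - 1 \<in> order_ge (Suc s)" and b: "\<And>j. b j \<in> order_ge (Suc s)"
      and approx: "u * mfps_subst (\<lambda>j. mfps_X j + b j) f - g \<in> order_ge (i + (Suc s + p))"
      using \<open>good p ub\<close> by (auto simp: good_def ub)
    obtain a c where ac: "con \<or> a = 0" "a \<in> order_ge (Suc s + p)" "\<And>j. c j \<in> order_ge (Suc s + p)"
      "(u + a) * mfps_subst (\<lambda>j. mfps_X j + (b j + c j)) f - g \<in> order_ge (Suc (i + (Suc s + p)))"
      using equivalence_step[OF f s(1) d base u(2) b approx] by blast
    have "a \<in> order_ge (Suc s)" "c j \<in> order_ge (Suc s)" for j
      using ac(2) ac(3)[of j] by (auto intro: order_ge_mono)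
    then have "good (Suc p) (u + a, \<lambda>j. b j + c j)"
      using ac u b order_ge_add[of "u - 1" "Suc s" a] by (auto simp: good_def algebra_simps intro: order_ge_add)
    moreover have "close p ub (u + a, \<lambda>j. b j + c j)"
      using ac(2,3) by (simp add: close_def ub add.commute)
    ultimately show "\<exists>ub'. good (Suc p) ub' \<and> close p ub ub'" by blast
  qed
  then obtain ub where ub: "\<And>p. good p (ub p)" "\<And>p. close p (ub p) (ub (Suc p))" by blast
  define u b where "u p = fst (ub p)" and "b p = snd (ub p)" for p
  have u: "con \<or> u p = 1" "u p - 1 \<in> order_ge (Suc s)" and b: "b p j \<in> order_ge (Suc s)"
    and approx: "u p * mfps_subst (\<lambda>j. mfps_X j + b p j) f - g \<in> order_ge (i + (Suc s + p))" for p j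
    using ub(1)[of p] by (auto simp: good_def u_def b_def case_prod_unfold)
  have u_close: "u (Suc p) - u p \<in> order_ge (p + Suc s)"
    and b_close: "b (Suc p) j - b p j \<in> order_ge (p + Suc s)" for p j
    using ub(2)[of p] by (auto simp: close_def u_def b_def case_prod_unfold)
  obtain u' where u': "\<And>p. u' - u p \<in> order_ge (p + Suc s)"
    using order_ge_complete[of u "Suc s", OF u_close] by blast
  have "\<exists>l. \<forall>p. l - b p j \<in> order_ge (p + Suc s)" for j
    using order_ge_complete[of "\<lambda>p. b p j" "Suc s", OF b_close] by blast
  then obtain b' where b': "\<And>p j. b' j - b p j \<in> order_ge (p + Suc s)"
    by metis
  show thesis
  proof (rule that)
    show "con \<or> u' = 1"
    proof (rule disjCI)
      assume "u' \<noteq> 1"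
      moreover have "u' = 1" if "\<not> con"
        using order_ge_mono[OF u'] u(1) that by (intro order_ge_separated[of u' 1]) (metis le_add1)
      ultimately show con by blast
    qed
    show "u' - 1 \<in> order_ge 1"
      using order_ge_mono[OF order_ge_add[OF u'[of 0, simplified] u(2)[of 0]], of 1] by simp
    show "b' j \<in> order_ge 2" for j
      using order_ge_mono[OF order_ge_add[OF b'[of j 0, simplified] b[of 0 j]], of 2] s by simp
    show "u' * mfps_subst (\<lambda>j. mfps_X j + b' j) f = g"
    proof (rule order_ge_separated)
      fix p
      define y where "y = (\<lambda>j. mfps_X j + b p j)"
      define z where "z = (\<lambda>j. mfps_X j + b' j)"
      have y: "y j \<in> order_ge 1" for j
        unfolding y_def using order_ge_mono[OF b] by (intro order_ge_add mfps_X_order_ge) simp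
      have "mfps_subst z f - mfps_subst y f \<in> order_ge (p + s + d)"
        using mfps_subst_increment_order_ge[of y "\<lambda>j. b' j - b p j" "p + s" f d] y b'[of _ p] f
        by (simp add: y_def z_def)
      then have 1: "u p * (mfps_subst z f - mfps_subst y f) \<in> order_ge p"
        by (intro order_ge_mult_left) (auto intro: order_ge_mono)
      have 2: "(u' - u p) * mfps_subst z f \<in> order_ge p"
        using order_ge_mono[OF u'] by (intro order_ge_mult_right) simp
      have 3: "u p * mfps_subst y f - g \<in> order_ge p"
        using order_ge_mono[OF approx] unfolding y_def by simp
      \<comment> \<open>The limit is compared with stage \<open>p\<close>: the changes in
        \<open>u\<close> and in the point are small by the rate of convergence, and the last term is
        the residual at stage \<open>p\<close>.\<close>
      have "u' * mfps_subst z f - g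
          = (u' - u p) * mfps_subst z f + u p * (mfps_subst z f - mfps_subst y f) + (u p * mfps_subst y f - g)"
        by (simp add: algebra_simps)
      also have "\<dots> \<in> order_ge p"
        by (intro order_ge_add 1 2 3)
      finally show "u' * mfps_subst (\<lambda>j. mfps_X j + b' j) f - g \<in> order_ge p"
        by (simp add: z_def)
    qed
  qed
qed

section \<open>From approximation to determinacy\<close>

lemma monom_not_in_order_ge:
  "(mfps_monom a :: ('n::finite, 'a::comm_ring_1) mfps) \<notin> order_ge (Suc (mdeg a))"
  using order_geD[of "mfps_monom a :: ('n, 'a) mfps" "Suc (mdeg a)" a] by (auto simp: mfps_nth_monom)

text \<open>The first claim gives \<open>s = i + 2 - d >= 1\<close>, so the iteration applies and
  the subtraction of natural numbers is not cut off.\<close>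

lemma equivalence_of_approximation:
  fixes f :: "('n::finite, 'a::comm_ring_1) mfps"
  assumes f: "f \<in> order_ge d" and d: "2 \<le> d"
    and base: "\<And>h. h \<in> order_ge i \<Longrightarrow> \<exists>a c. (con \<or> a = 0) \<and>
        h - (a * f + (\<Sum>j\<in>UNIV. c j * mfps_pderiv j f)) \<in> order_ge (Suc i)"
  shows "d \<le> Suc i"
    and "f - g \<in> order_ge (2 * i + 3 - d) \<Longrightarrow> \<exists>u b. (con \<or> u = 1) \<and> u - 1 \<in> order_ge 1 \<and>
        (\<forall>j. b j \<in> order_ge 2) \<and> u * mfps_subst (\<lambda>j. mfps_X j + b j) f = g"
proof -
  show le: "d \<le> Suc i"
  proof (rule ccontr)
    assume "\<not> d \<le> Suc i"
    then have d': "Suc i \<le> d - 1" by simp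
    \<comment> \<open>A power of an arbitrary variable serves as witness. If \<open>d - 1\<close>
      exceeded \<open>i\<close>, all combinations of \<open>f\<close> and its derivatives would lie
      in \<open>m^(i+1)\<close> and could not absorb a monomial of degree \<open>i\<close>.\<close>
    define m :: "'n \<Rightarrow>\<^sub>0 nat" where "m = Poly_Mapping.single undefined i"
    define h :: "('n, 'a) mfps" where "h = mfps_monom m"
    have m: "mdeg m = i"
      by (simp add: m_def)
    then have "h \<in> order_ge i"
      unfolding h_def using mfps_monom_order_ge by metis
    from base[OF this] obtain a c
      where "h - (a * f + (\<Sum>j\<in>UNIV. c j * mfps_pderiv j f)) \<in> order_ge (Suc i)" by blast
    moreover have "a * f + (\<Sum>j\<in>UNIV. c j * mfps_pderiv j f) \<in> order_ge (Suc i)"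
      using order_ge_mono[OF f, of "Suc i"] order_ge_mono[OF pderiv_order_ge[OF f] d'] d'
      by (intro order_ge_add order_ge_sum order_ge_mult_left) auto
    ultimately have "h \<in> order_ge (Suc i)"
      using order_ge_add by fastforce
    then show False
      unfolding h_def using monom_not_in_order_ge m by metis
  qed
  assume "f - g \<in> order_ge (2 * i + 3 - d)"
  moreover have "2 * i + 3 - d = i + Suc (i + 2 - d)"
    using le by simp
  ultimately have g: "f - g \<in> order_ge (i + Suc (i + 2 - d))"
    by simp
  show "\<exists>u b. (con \<or> u = 1) \<and> u - 1 \<in> order_ge 1 \<and>
        (\<forall>j. b j \<in> order_ge 2) \<and> u * mfps_subst (\<lambda>j. mfps_X j + b j) f = g"
    by (rule exists_equivalence[OF f _ _ _ base g]) (use le d in auto)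
qed

lemma right_determined_if_approximation:
  fixes f :: "('n::finite, 'k::field) mfps"
  assumes f: "f \<in> order_ge d" "2 \<le> d"
    and base: "\<And>h. h \<in> order_ge i \<Longrightarrow>
        \<exists>j\<in>ideal_gen (range (\<lambda>i. mfps_pderiv i f)). h - j \<in> order_ge (Suc i)"
  shows "d \<le> Suc i" "right_determined (2 * i + 2 - d) f"
proof -
  have base': "\<exists>a c. (False \<or> a = 0) \<and> h - (a * f + (\<Sum>j\<in>UNIV. c j * mfps_pderiv j f)) \<in> order_ge (Suc i)"
    if h: "h \<in> order_ge i" for h
  proof -
    \<comment> \<open>Adjoining 0 as an extra generator brings the Jacobian ideal into the form with
      a distinguished first generator, whose multiple vanishes.\<close>
    obtain r where "r \<in> ideal_gen (insert 0 (range (\<lambda>i. mfps_pderiv i f)))" "h - r \<in> order_ge (Suc i)"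
      using base[OF h] ideal.span_mono[OF subset_insertI] by blast
    then show ?thesis
      by (auto elim!: ideal_gen_insert_rangeD)
  qed
  show le: "d \<le> Suc i"
    using equivalence_of_approximation(1)[OF f base'] .
  have "right_equivalent f g" if "f - g \<in> ideal_pow mfps_max_ideal (2 * i + 2 - d + 1)" for g
  proof -
    \<comment> \<open>Being \<open>k\<close>-determined concerns errors in \<open>m^(k+1)\<close>;
      hence 3 here and 2 in the bound.\<close>
    have "2 * i + 2 - d + 1 = 2 * i + 3 - d"
      using le by simp
    with that have "f - g \<in> order_ge (2 * i + 3 - d)"
      using ideal_pow_subset_order_ge by (metis subsetD)
    from equivalence_of_approximation(2)[OF f base' this]
    obtain b where b: "\<And>j. b j \<in> order_ge 2" "mfps_subst (\<lambda>j. mfps_X j + b j) f = g"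
      by auto
    let ?\<phi> = "mfps_subst (\<lambda>j. mfps_X j + b j)"
    have aut: "mfps_automorphism ?\<phi>"
      by (rule mfps_automorphism_subst[OF b(1)])
    then have "inj ?\<phi>"
      by (simp add: mfps_automorphism_def bij_is_inj)
    then have "inv ?\<phi> (?\<phi> f) = f"
      by (rule inv_f_f)
    then have "f = inv ?\<phi> g"
      by (simp only: b(2))
    with mfps_automorphism_inv[OF aut] show ?thesis
      unfolding right_equivalent_def by blast
  qed
  then show "right_determined (2 * i + 2 - d) f"
    by (simp add: right_determined_def)
qed

lemma contact_determined_if_approximation:
  fixes f :: "('n::finite, 'k::field) mfps"
  assumes f: "f \<in> order_ge d" "2 \<le> d"
    and base: "\<And>h. h \<in> order_ge i \<Longrightarrow>
        \<exists>j\<in>ideal_gen (insert f (range (\<lambda>i. mfps_pderiv i f))). h - j \<in> order_ge (Suc i)"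
  shows "d \<le> Suc i" "contact_determined (2 * i + 2 - d) f"
proof -
  have base': "\<exists>a c. (True \<or> a = 0) \<and> h - (a * f + (\<Sum>j\<in>UNIV. c j * mfps_pderiv j f)) \<in> order_ge (Suc i)"
    if h: "h \<in> order_ge i" for h
    using base[OF h] by (auto elim!: ideal_gen_insert_rangeD)
  show le: "d \<le> Suc i"
    using equivalence_of_approximation(1)[OF f base'] .
  have "contact_equivalent f g" if "f - g \<in> ideal_pow mfps_max_ideal (2 * i + 2 - d + 1)" for g
  proof -
    have "2 * i + 2 - d + 1 = 2 * i + 3 - d"
      using le by simp
    with that have "f - g \<in> order_ge (2 * i + 3 - d)"
      using ideal_pow_subset_order_ge by (metis subsetD)
    from equivalence_of_approximation(2)[OF f base' this]
    obtain u b where u: "u - 1 \<in> order_ge 1" and b: "\<And>j. b j \<in> order_ge 2"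
      and g: "u * mfps_subst (\<lambda>j. mfps_X j + b j) f = g"
      by auto
    obtain v where v: "u * v = 1"
      using unit_if_one_mod_order_ge[OF u] by (metis dvdE)
    let ?\<phi> = "mfps_subst (\<lambda>j. mfps_X j + b j)"
    have aut: "mfps_automorphism ?\<phi>"
      by (rule mfps_automorphism_subst[OF b])
    define \<psi> where "\<psi> = inv ?\<phi>"
    have \<psi>: "mfps_automorphism \<psi>"
      unfolding \<psi>_def by (rule mfps_automorphism_inv[OF aut])
    then have mult: "\<psi> (x * y) = \<psi> x * \<psi> y" and one: "\<psi> 1 = 1" for x y
      by (auto simp: mfps_automorphism_def)
    have "inj ?\<phi>"
      using aut by (simp add: mfps_automorphism_def bij_is_inj)
    then have "\<psi> (?\<phi> f) = f"
      unfolding \<psi>_def by (rule inv_f_f)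
    \<comment> \<open>Applying \<open>\<psi>\<close> to \<open>g = u * f(x + b)\<close> leaves the
      factor \<open>\<psi> u\<close>, which is a unit with inverse \<open>\<psi> v\<close>.\<close>
    then have "\<psi> g = \<psi> u * f"
      using mult[of u "?\<phi> f"] by (simp only: g)
    moreover have vu: "\<psi> v * \<psi> u = 1"
      using mult one v by (metis mult.commute)
    ultimately have "f = \<psi> v * \<psi> g"
      by (metis mult.assoc mult_1)
    moreover have "\<psi> v dvd 1"
      using vu by (metis dvdI)
    ultimately show ?thesis
      unfolding contact_equivalent_def using \<psi> by blast
  qed
  then show "contact_determined (2 * i + 2 - d) f"
    by (simp add: contact_determined_def)
qed

text \<open>\<open>quotient_dim\<close> selects some basis by choice; \<open>quotient_dim_eq\<close>
  makes its value the size of the basis at hand.\<close>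

lemma quotient_dim_order_ge_absorbed:
  fixes I :: "('n::finite, 'k::field) mfps set"
  assumes "mfps_vs.subspace I" "quotient_dim I < \<infinity>"
  obtains i where "i \<le> the_enat (quotient_dim I)"
    "\<And>h. h \<in> order_ge i \<Longrightarrow> \<exists>j\<in>I. h - j \<in> order_ge (Suc i)"
proof -
  obtain B where B: "basis_mod I B"
    using assms(2) by (auto simp: quotient_dim_def split: if_splits)
  show thesis
    using basis_mod_order_ge_absorbed[OF assms(1) B] that quotient_dim_eq[OF assms(1) B] by auto
qed

theorem corollary2p4:
  fixes f :: "('n::finite, 'k::alg_closed_field) mfps"
  assumes "f \<noteq> 0" and "f \<in> ideal_pow mfps_max_ideal 2"
  shows "(milnor_number f < \<infinity> \<longrightarrow>
           (\<exists>k. right_determined k f) \<and>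
           int (right_determinacy f) \<le> 2 * int (the_enat (milnor_number f)) - int (mfps_ord f) + 2)
       \<and> (tjurina_number f < \<infinity> \<longrightarrow>
           (\<exists>k. contact_determined k f) \<and>
           int (contact_determinacy f) \<le> 2 * int (the_enat (tjurina_number f)) - int (mfps_ord f) + 2)"
proof (intro conjI[of "_ \<longrightarrow> _"] impI)
  have f: "f \<in> order_ge (mfps_ord f)" "2 \<le> mfps_ord f"
    using mfps_ord[OF assms(1)] assms(2) ideal_pow_subset_order_ge by auto
  {
    assume "milnor_number f < \<infinity>"
    then obtain i where i: "i \<le> the_enat (milnor_number f)"
      and base: "\<And>h. h \<in> order_ge i \<Longrightarrow>
        \<exists>j\<in>ideal_gen (range (\<lambda>i. mfps_pderiv i f)). h - j \<in> order_ge (Suc i)"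
      unfolding milnor_number_def using quotient_dim_order_ge_absorbed[OF subspace_ideal_gen] by blast
    have det: "right_determined (2 * i + 2 - mfps_ord f) f"
      by (rule right_determined_if_approximation(2)[OF f base])
    then have "right_determinacy f \<le> 2 * i + 2 - mfps_ord f"
      unfolding right_determinacy_def by (rule Least_le)
    \<comment> \<open>Since \<open>mfps_ord f <= i + 1\<close>, the natural subtraction agrees with
      the integer one, and the bound grows with \<open>i\<close>.\<close>
    with det i right_determined_if_approximation(1)[OF f base]
    show "(\<exists>k. right_determined k f) \<and>
        int (right_determinacy f) \<le> 2 * int (the_enat (milnor_number f)) - int (mfps_ord f) + 2"
      by auto
  next
    assume "tjurina_number f < \<infinity>"
    then obtain i where i: "i \<le> the_enat (tjurina_number f)"
      and base: "\<And>h. h \<in> order_ge i \<Longrightarrow>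
        \<exists>j\<in>ideal_gen (insert f (range (\<lambda>i. mfps_pderiv i f))). h - j \<in> order_ge (Suc i)"
      unfolding tjurina_number_def using quotient_dim_order_ge_absorbed[OF subspace_ideal_gen] by blast
    have det: "contact_determined (2 * i + 2 - mfps_ord f) f"
      by (rule contact_determined_if_approximation(2)[OF f base])
    then have "contact_determinacy f \<le> 2 * i + 2 - mfps_ord f"
      unfolding contact_determinacy_def by (rule Least_le)
    with det i contact_determined_if_approximation(1)[OF f base]
    show "(\<exists>k. contact_determined k f) \<and>
        int (contact_determinacy f) \<le> 2 * int (the_enat (tjurina_number f)) - int (mfps_ord f) + 2"
      by auto
  }
qed

end
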